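(* Let $(u_k)_{k\ge 0}\subset V$ be generated by NGMRES-Picard with $m=0$ from an initial guess $u_0\in V$, i.e. for each $k\ge 0$: $\tilde u_{k+1}=q(u_k)$; $\alpha^{k+1}\in\mathbb{R}$ is a minimizer of $\alpha\mapsto\|\alpha\, g(\tilde u_{k+1})+(1-\alpha)\,g(u_k)\|_{V'}$ over $\alpha\in\mathbb{R}$; and $u_{k+1}=\alpha^{k+1}\tilde u_{k+1}+(1-\alpha^{k+1})u_k$. Assume that $\max_k|\alpha^k|\le\bar\alpha$ for some $\bar\alpha>0$. Then for any $\kappa>0$ the nonlinear residual at step $k+1$ satisfies $$\|g(u_{k+1})\|_{V'}\le \theta_{k+1}\|g(u_k)\|_{V'}+M\nu^{-2}\bar\alpha(1+\bar\alpha)\|g(u_k)\|_{V'}^2,$$ $$\|g(u_{k+1})\|_{V'}\le \gamma_{k+1}\kappa\|g(u_k)\|_{V'}+M\nu^{-2}\bar\alpha(1+\bar\alpha)\|g(u_k)\|_{V'}^2,$$ where $$\theta_{k+1}=\frac{\|\alpha^{k+1}g(\tilde u_{k+1})+(1-\alpha^{k+1})g(u_k)\|_{V'}}{\|g(u_k)\|_{V'}},\qquad \gamma_{k+1}=\frac{\|\alpha^{k+1}g(\tilde u_{k+1})+(1-\alpha^{k+1})g(u_k)\|_{V'}}{\|g(\tilde u_{k+1})\|_{V'}},$$ each bound being asserted at those steps where the denominator of the corresponding quotient $\theta_{k+1}$, respectively $\gamma_{k+1}$, is nonzero.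
   Context: Let $\Omega\subset\mathbb{R}^d$ ($d=2$ or $3$) be a bounded open connected set, $\nu>0$, and $f\in H^{-1}(\Omega)$ (vector valued). $\|\cdot\|$ and $(\cdot,\cdot)$ denote the $L^2(\Omega)$ norm and inner product; $(\cdot,\cdot)$ also denotes dual pairings. Let $X=H^1_0(\Omega)^d$ and $Q=\{q\in L^2(\Omega):\int_\Omega q\,dx=0\}$, and let $V=\{v\in X:(\nabla\cdot v,q)=0\ \forall q\in Q\}$ be the divergence-free subspace, with dual $V'$. Dual norms are taken with respect to $\|\nabla\cdot\|$: $\|F\|_{V'}=\sup_{0\ne\chi\in V}(F,\chi)/\|\nabla\chi\|$ and $\|f\|_{-1}=\|f\|_{H^{-1}}=\sup_{0\ne\chi\in X}(f,\chi)/\|\nabla\chi\|$. $M$ is a constant, depending only on the size of $\Omega$, such that for all $v,w,\chi\in X$: $(v\cdot\nabla w,\chi)\le M\|\nabla v\|\|\nabla w\|\|\nabla\chi\|$ and $\|v\cdot\nabla w\|_{V'}\le M\|\nabla v\|\|\nabla w\|$. Set $\kappa:=M\nu^{-2}\|f\|_{-1}$. The Picard solution operator $q:V\to V$ for the steady Navier-Stokes equations is defined by: for $v\in V$, $q(v)\in V$ is the unique solution of $\nu(\nabla q(v),\nabla\chi)+(v\cdot\nabla q(v),\chi)=(f,\chi)$ for all $\chi\in V$. The nonlinear residual $g:V\to V'$ is defined by $(g(v),\chi)=\nu(\nabla v,\nabla\chi)+(v\cdot\nabla v,\chi)-(f,\chi)$ for all $\chi\in V$. *)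

theory Defs
  imports "HOL-Analysis.Analysis"
begin

(* Elements of L^2, H^1_0 etc. are represented by functions on the whole space of which only the
   values on \<Omega> matter; equality in these spaces is equality almost everywhere on \<Omega>. *)

definition L2_space :: "'a::euclidean_space set \<Rightarrow> ('a \<Rightarrow> 'b::euclidean_space) set" where
  "L2_space \<Omega> = {u. u \<in> borel_measurable (lebesgue_on \<Omega>) \<and>
                     integrable (lebesgue_on \<Omega>) (\<lambda>x. (norm (u x))\<^sup>2)}"

definition L2_inner :: "'a::euclidean_space set \<Rightarrow> ('a \<Rightarrow> 'b::euclidean_space) \<Rightarrow> ('a \<Rightarrow> 'b) \<Rightarrow> real" where
  "L2_inner \<Omega> u v = (LINT x|lebesgue_on \<Omega>. u x \<bullet> v x)"

definition L2_norm :: "'a::euclidean_space set \<Rightarrow> ('a \<Rightarrow> 'b::euclidean_space) \<Rightarrow> real" where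
  "L2_norm \<Omega> u = sqrt (L2_inner \<Omega> u u)"

definition partial :: "'d \<Rightarrow> (real^'d::finite \<Rightarrow> real) \<Rightarrow> real^'d \<Rightarrow> real" where
  "partial j \<phi> x = frechet_derivative \<phi> (at x) (axis j 1)"

primrec C_k :: "nat \<Rightarrow> (real^'d::finite \<Rightarrow> real) \<Rightarrow> bool" where
  "C_k 0 \<phi> \<longleftrightarrow> continuous_on UNIV \<phi>"
| "C_k (Suc k) \<phi> \<longleftrightarrow> (\<forall>x. \<phi> differentiable (at x)) \<and> (\<forall>j. C_k k (partial j \<phi>))"

definition test_functions :: "(real^'d::finite) set \<Rightarrow> (real^'d \<Rightarrow> real) set" where
  "test_functions \<Omega> = {\<phi>. (\<forall>k. C_k k \<phi>) \<and> compact (closure {x. \<phi> x \<noteq> 0}) \<and>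
                          closure {x. \<phi> x \<noteq> 0} \<subseteq> \<Omega>}"

definition has_weak_gradient ::
    "(real^'d::finite) set \<Rightarrow> (real^'d \<Rightarrow> real) \<Rightarrow> (real^'d \<Rightarrow> real^'d) \<Rightarrow> bool" where
  "has_weak_gradient \<Omega> u G \<longleftrightarrow>
     (\<forall>\<phi>\<in>test_functions \<Omega>. \<forall>j.
        (LINT x|lebesgue_on \<Omega>. u x * partial j \<phi> x) = - (LINT x|lebesgue_on \<Omega>. G x $ j * \<phi> x))"

(* u belongs to H^1, with weak gradient G, and lies in the H^1-closure of the test functions. *)
definition H10_gradient ::
    "(real^'d::finite) set \<Rightarrow> (real^'d \<Rightarrow> real) \<Rightarrow> (real^'d \<Rightarrow> real^'d) \<Rightarrow> bool" where
  "H10_gradient \<Omega> u G \<longleftrightarrow>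
     u \<in> L2_space \<Omega> \<and> G \<in> L2_space \<Omega> \<and> has_weak_gradient \<Omega> u G \<and>
     (\<exists>\<phi>. (\<forall>n::nat. \<phi> n \<in> test_functions \<Omega>) \<and>
          (\<lambda>n. L2_norm \<Omega> (\<lambda>x. \<phi> n x - u x)) \<longlonglongrightarrow> 0 \<and>
          (\<lambda>n. L2_norm \<Omega> (\<lambda>x. (\<chi> j. partial j (\<phi> n) x) - G x)) \<longlonglongrightarrow> 0)"

definition H10 :: "(real^'d::finite) set \<Rightarrow> (real^'d \<Rightarrow> real) set" where
  "H10 \<Omega> = {u. \<exists>G. H10_gradient \<Omega> u G}"

(* The weak gradient is unique up to null sets, so the choice is immaterial. *)
definition weak_grad :: "(real^'d::finite) set \<Rightarrow> (real^'d \<Rightarrow> real) \<Rightarrow> real^'d \<Rightarrow> real^'d" where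
  "weak_grad \<Omega> u = (SOME G. H10_gradient \<Omega> u G)"

definition X_space :: "(real^'d::finite) set \<Rightarrow> (real^'d \<Rightarrow> real^'d) set" where
  "X_space \<Omega> = {v. \<forall>i. (\<lambda>x. v x $ i) \<in> H10 \<Omega>}"

(* Jacobian matrix; row i is the weak gradient of the i-th component. *)
definition grad :: "(real^'d::finite) set \<Rightarrow> (real^'d \<Rightarrow> real^'d) \<Rightarrow> real^'d \<Rightarrow> real^'d^'d" where
  "grad \<Omega> v x = (\<chi> i. weak_grad \<Omega> (\<lambda>y. v y $ i) x)"

definition divergence :: "(real^'d::finite) set \<Rightarrow> (real^'d \<Rightarrow> real^'d) \<Rightarrow> real^'d \<Rightarrow> real" where
  "divergence \<Omega> v x = (\<Sum>i\<in>UNIV. grad \<Omega> v x $ i $ i)"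

definition Q_space :: "(real^'d::finite) set \<Rightarrow> (real^'d \<Rightarrow> real) set" where
  "Q_space \<Omega> = {q \<in> L2_space \<Omega>. (LINT x|lebesgue_on \<Omega>. q x) = 0}"

definition V_space :: "(real^'d::finite) set \<Rightarrow> (real^'d \<Rightarrow> real^'d) set" where
  "V_space \<Omega> = {v \<in> X_space \<Omega>. \<forall>q\<in>Q_space \<Omega>. L2_inner \<Omega> (divergence \<Omega> v) q = 0}"

definition grad_norm :: "(real^'d::finite) set \<Rightarrow> (real^'d \<Rightarrow> real^'d) \<Rightarrow> real" where
  "grad_norm \<Omega> v = L2_norm \<Omega> (grad \<Omega> v)"

(* Inserting 0 does not change the supremum for a linear F, since the set of quotients is symmetric;
   it only fixes the value when W is the zero space. *)
definition dual_norm ::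
    "(real^'d::finite) set \<Rightarrow> (real^'d \<Rightarrow> real^'d) set \<Rightarrow> ((real^'d \<Rightarrow> real^'d) \<Rightarrow> real) \<Rightarrow> real" where
  "dual_norm \<Omega> W F =
     Sup (insert 0 {F w / grad_norm \<Omega> w | w. w \<in> W \<and> \<not> (AE x in lebesgue_on \<Omega>. w x = 0)})"

definition V_dual_norm :: "(real^'d::finite) set \<Rightarrow> ((real^'d \<Rightarrow> real^'d) \<Rightarrow> real) \<Rightarrow> real" where
  "V_dual_norm \<Omega> = dual_norm \<Omega> (V_space \<Omega>)"

definition Hm1_norm :: "(real^'d::finite) set \<Rightarrow> ((real^'d \<Rightarrow> real^'d) \<Rightarrow> real) \<Rightarrow> real" where
  "Hm1_norm \<Omega> = dual_norm \<Omega> (X_space \<Omega>)"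

(* Vector-valued H^{-1}: the bounded linear functionals on X.  Boundedness makes f depend only on
   the almost-everywhere class of its argument. *)
definition Hm1 :: "(real^'d::finite) set \<Rightarrow> ((real^'d \<Rightarrow> real^'d) \<Rightarrow> real) set" where
  "Hm1 \<Omega> = {f. (\<forall>v\<in>X_space \<Omega>. \<forall>w\<in>X_space \<Omega>. \<forall>a b.
                   f (\<lambda>x. a *\<^sub>R v x + b *\<^sub>R w x) = a * f v + b * f w) \<and>
               (\<exists>C. \<forall>v\<in>X_space \<Omega>. \<bar>f v\<bar> \<le> C * grad_norm \<Omega> v)}"

(* The pairing of (v . nabla) w, whose i-th component is the sum over j of v_j d_j w_i, with z. *)
definition convection ::
    "(real^'d::finite) set \<Rightarrow> (real^'d \<Rightarrow> real^'d) \<Rightarrow> (real^'d \<Rightarrow> real^'d) \<Rightarrow> (real^'d \<Rightarrow> real^'d) \<Rightarrow> real" where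
  "convection \<Omega> v w z = L2_inner \<Omega> (\<lambda>x. grad \<Omega> w x *v v x) z"

definition convection_bound :: "(real^'d::finite) set \<Rightarrow> real \<Rightarrow> bool" where
  "convection_bound \<Omega> M \<longleftrightarrow>
     (\<forall>v\<in>X_space \<Omega>. \<forall>w\<in>X_space \<Omega>. \<forall>z\<in>X_space \<Omega>.
        convection \<Omega> v w z \<le> M * grad_norm \<Omega> v * grad_norm \<Omega> w * grad_norm \<Omega> z) \<and>
     (\<forall>v\<in>X_space \<Omega>. \<forall>w\<in>X_space \<Omega>.
        V_dual_norm \<Omega> (convection \<Omega> v w) \<le> M * grad_norm \<Omega> v * grad_norm \<Omega> w)"

definition kappa :: "(real^'d::finite) set \<Rightarrow> real \<Rightarrow> real \<Rightarrow> ((real^'d \<Rightarrow> real^'d) \<Rightarrow> real) \<Rightarrow> real" where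
  "kappa \<Omega> M \<nu> f = M * \<nu> powi (-2) * Hm1_norm \<Omega> f"

(* picard_solution \<Omega> \<nu> f v w says w = q(v) for the Picard operator q.  As an element of V (that is, up
   to null sets) the solution w is unique, so q is given by its graph on representatives. *)
definition picard_solution ::
    "(real^'d::finite) set \<Rightarrow> real \<Rightarrow> ((real^'d \<Rightarrow> real^'d) \<Rightarrow> real) \<Rightarrow>
     (real^'d \<Rightarrow> real^'d) \<Rightarrow> (real^'d \<Rightarrow> real^'d) \<Rightarrow> bool" where
  "picard_solution \<Omega> \<nu> f v w \<longleftrightarrow>
     w \<in> V_space \<Omega> \<and>
     (\<forall>z\<in>V_space \<Omega>. \<nu> * L2_inner \<Omega> (grad \<Omega> w) (grad \<Omega> z) + convection \<Omega> v w z = f z)"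

definition residual ::
    "(real^'d::finite) set \<Rightarrow> real \<Rightarrow> ((real^'d \<Rightarrow> real^'d) \<Rightarrow> real) \<Rightarrow>
     (real^'d \<Rightarrow> real^'d) \<Rightarrow> (real^'d \<Rightarrow> real^'d) \<Rightarrow> real" where
  "residual \<Omega> \<nu> f v z = \<nu> * L2_inner \<Omega> (grad \<Omega> v) (grad \<Omega> z) + convection \<Omega> v v z - f z"

definition mixed_residual_norm ::
    "(real^'d::finite) set \<Rightarrow> real \<Rightarrow> ((real^'d \<Rightarrow> real^'d) \<Rightarrow> real) \<Rightarrow>
     (real^'d \<Rightarrow> real^'d) \<Rightarrow> (real^'d \<Rightarrow> real^'d) \<Rightarrow> real \<Rightarrow> real" where
  "mixed_residual_norm \<Omega> \<nu> f w v a =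
     V_dual_norm \<Omega> (\<lambda>z. a * residual \<Omega> \<nu> f w z + (1 - a) * residual \<Omega> \<nu> f v z)"

definition ngmres0_picard ::
    "(real^'d::finite) set \<Rightarrow> real \<Rightarrow> ((real^'d \<Rightarrow> real^'d) \<Rightarrow> real) \<Rightarrow>
     (nat \<Rightarrow> real^'d \<Rightarrow> real^'d) \<Rightarrow> (nat \<Rightarrow> real^'d \<Rightarrow> real^'d) \<Rightarrow> (nat \<Rightarrow> real) \<Rightarrow> bool" where
  "ngmres0_picard \<Omega> \<nu> f u ut \<alpha> \<longleftrightarrow>
     (\<forall>k. u k \<in> V_space \<Omega>) \<and>
     (\<forall>k. picard_solution \<Omega> \<nu> f (u k) (ut (Suc k)) \<and>
          is_arg_min (mixed_residual_norm \<Omega> \<nu> f (ut (Suc k)) (u k)) (\<lambda>_. True) (\<alpha> (Suc k)) \<and>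
          (AE x in lebesgue_on \<Omega>.
             u (Suc k) x = \<alpha> (Suc k) *\<^sub>R ut (Suc k) x + (1 - \<alpha> (Suc k)) *\<^sub>R u k x))"

end

theory Submission
  imports Defs
begin

text \<open>
  Write \<open>v = u\<^sub>k\<close>, let \<open>w\<close> be the Picard update of \<open>v\<close>, and put \<open>e = w - v\<close>, \<open>N = \<parallel>g(v)\<parallel>\<close>.

  Subtracting the Picard equation from the definition of the residual gives
  \<open>g(v) = - \<nu> (\<nabla>e, \<nabla>\<cdot>) - (v \<cdot> \<nabla>e, \<cdot>)\<close> and \<open>g(w) = (e \<cdot> \<nabla>w, \<cdot>)\<close> on \<open>V\<close>.  The convection form is skew,
  \<open>(v \<cdot> \<nabla>e, e) = 0\<close> for \<open>v\<close> in \<open>V\<close> (\<open>convection_skew\<close>).  Testing the first identity with \<open>- e\<close> therefore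
  yields \<open>\<nu> \<parallel>\<nabla>e\<parallel> \<le> N\<close> (\<open>picard_increment_norm_le\<close>), and testing the Picard equation with \<open>w\<close> yields
  \<open>\<nu> \<parallel>\<nabla>w\<parallel> \<le> \<parallel>f\<parallel>\<close> (\<open>picard_solution_norm_le\<close>).  Inserted into the second identity these two bounds give
  \<open>\<parallel>g(w)\<parallel> \<le> \<kappa> N\<close> (\<open>picard_residual_le\<close>).  The residual is quadratic and its second-order part is convection, so
  \<open>g(\<alpha> w + (1 - \<alpha>) v) = \<alpha> g(w) + (1 - \<alpha>) g(v) - \<alpha> (1 - \<alpha>) (e \<cdot> \<nabla>e, \<cdot>)\<close> (\<open>residual_of_mixture\<close>), and the
  last term is at most \<open>M \<nu>\<^sup>-\<^sup>2 \<bar>\<alpha>\<bar> \<bar>1 - \<alpha>\<bar> N\<^sup>2\<close> in the dual norm.  The norm of the linear part is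
  \<open>\<theta> N\<close> where \<open>N \<noteq> 0\<close> and \<open>\<gamma> \<parallel>g(w)\<parallel> \<le> \<gamma> \<kappa> N\<close> where \<open>g(w) \<noteq> 0\<close>, which proves the two bounds.

  The analytic work lies in justifying this algebra.  Since the integral of a function that is not integrable
  is \<open>0\<close> by convention, the additivity of convection in its arguments rests on the integrability of
  \<open>(v \<cdot> \<nabla>w) \<cdot> z\<close>.  This follows from the embedding of \<open>H\<^sup>1\<^sub>0\<close> into \<open>L\<^sup>4\<close>, for which Ladyzhenskaya's
  inequality is proved in dimensions two and three (\<open>Ladyzhenskaya\<close>, \<open>H10_fourth_power_integrable\<close>).  Weak gradients depend linearly on the function
  because they are unique almost everywhere (\<open>H10_gradient_unique\<close>).  Skew-symmetry is an integration by parts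
  for test functions (\<open>convection_test_field\<close>), extended to \<open>X\<close> by density.
\<close>

section \<open>Test functions\<close>

lemma C_k_Suc_D: "C_k (Suc k) \<phi> \<Longrightarrow> C_k k \<phi>"
proof (induction k arbitrary: \<phi>)
  case 0
  then show ?case
    by (auto intro!: continuous_at_imp_continuous_on differentiable_imp_continuous_within)
next
  case (Suc k)
  then show ?case by (metis C_k.simps(2))
qed

lemma partial_lincomb:
  fixes \<phi> \<psi> :: "real^'d \<Rightarrow> real"
  assumes "\<phi> differentiable (at x)" "\<psi> differentiable (at x)"
  shows "partial j (\<lambda>x. a * \<phi> x + b * \<psi> x) x = a * partial j \<phi> x + b * partial j \<psi> x"
proof -
  let ?A = "frechet_derivative \<phi> (at x)" and ?B = "frechet_derivative \<psi> (at x)"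
  have "(\<phi> has_derivative ?A) (at x)" "(\<psi> has_derivative ?B) (at x)"
    using assms by (auto simp: frechet_derivative_works)
  then have "((\<lambda>x. a * \<phi> x + b * \<psi> x) has_derivative (\<lambda>h. a * ?A h + b * ?B h)) (at x)"
    by (auto intro!: derivative_eq_intros)
  from fun_cong[OF frechet_derivative_at[OF this], of "axis j 1"] show ?thesis
    unfolding partial_def by simp
qed

lemma partial_mult:
  fixes \<phi> \<psi> :: "real^'d \<Rightarrow> real"
  assumes "\<phi> differentiable (at x)" "\<psi> differentiable (at x)"
  shows "partial j (\<lambda>x. \<phi> x * \<psi> x) x = \<phi> x * partial j \<psi> x + partial j \<phi> x * \<psi> x"
proof -
  let ?A = "frechet_derivative \<phi> (at x)" and ?B = "frechet_derivative \<psi> (at x)"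
  have "(\<phi> has_derivative ?A) (at x)" "(\<psi> has_derivative ?B) (at x)"
    using assms by (auto simp: frechet_derivative_works)
  then have "((\<lambda>x. \<phi> x * \<psi> x) has_derivative (\<lambda>h. \<phi> x * ?B h + ?A h * \<psi> x)) (at x)"
    by (auto intro!: derivative_eq_intros)
  from fun_cong[OF frechet_derivative_at[OF this], of "axis j 1"] show ?thesis
    unfolding partial_def by simp
qed

lemma C_k_lincomb: "C_k k \<phi> \<Longrightarrow> C_k k \<psi> \<Longrightarrow> C_k k (\<lambda>x. a * \<phi> x + b * \<psi> x)"
proof (induction k arbitrary: \<phi> \<psi>)
  case 0
  then show ?case by (auto intro!: continuous_intros)
next
  case (Suc k)
  have "partial j (\<lambda>x. a * \<phi> x + b * \<psi> x) = (\<lambda>x. a * partial j \<phi> x + b * partial j \<psi> x)" for j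
    using Suc.prems by (auto simp: partial_lincomb fun_eq_iff)
  then show ?case using Suc by (auto intro!: derivative_intros)
qed

lemma C_k_mult: "C_k k \<phi> \<Longrightarrow> C_k k \<psi> \<Longrightarrow> C_k k (\<lambda>x. \<phi> x * \<psi> x)"
proof (induction k arbitrary: \<phi> \<psi>)
  case 0
  then show ?case unfolding C_k.simps by (rule continuous_on_mult)
next
  case (Suc k)
  have eq: "partial j (\<lambda>x. \<phi> x * \<psi> x) = (\<lambda>x. 1 * (\<phi> x * partial j \<psi> x) + 1 * (partial j \<phi> x * \<psi> x))" for j
  proof
    fix x show "partial j (\<lambda>x. \<phi> x * \<psi> x) x = 1 * (\<phi> x * partial j \<psi> x) + 1 * (partial j \<phi> x * \<psi> x)"
      using partial_mult[of \<phi> x \<psi> j] Suc.prems unfolding C_k.simps by simp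
  qed
  have "C_k k (\<lambda>x. 1 * (\<phi> x * partial j \<psi> x) + 1 * (partial j \<phi> x * \<psi> x))" for j
  proof (rule C_k_lincomb)
    have p: "C_k k (partial j \<phi>)" "C_k k (partial j \<psi>)" using Suc.prems unfolding C_k.simps by blast+
    show "C_k k (\<lambda>x. \<phi> x * partial j \<psi> x)"
      by (rule Suc.IH[OF C_k_Suc_D[OF Suc.prems(1)] p(2)])
    show "C_k k (\<lambda>x. partial j \<phi> x * \<psi> x)"
      by (rule Suc.IH[OF p(1) C_k_Suc_D[OF Suc.prems(2)]])
  qed
  then have "C_k k (partial j (\<lambda>x. \<phi> x * \<psi> x))" for j
    unfolding eq .
  moreover have "\<forall>x. (\<lambda>x. \<phi> x * \<psi> x) differentiable (at x)"
    using Suc.prems unfolding C_k.simps by (blast intro: differentiable_mult)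
  ultimately show ?case unfolding C_k.simps by blast
qed

lemma test_functionsI:
  assumes "\<And>k. C_k k \<phi>" "compact K" "K \<subseteq> \<Omega>" "\<And>x. x \<notin> K \<Longrightarrow> \<phi> x = 0"
  shows "\<phi> \<in> test_functions \<Omega>"
proof -
  have "closure {x. \<phi> x \<noteq> 0} \<subseteq> K"
    using assms by (intro closure_minimal) (auto intro: compact_imp_closed)
  moreover from this have "compact (closure {x. \<phi> x \<noteq> 0})"
    using \<open>compact K\<close> by (metis closed_closure compact_Int_closed inf.absorb2 inf_commute)
  ultimately show ?thesis using assms by (auto simp: test_functions_def)
qed

lemma test_function_support:
  assumes "\<phi> \<in> test_functions \<Omega>"
  shows "\<exists>K. compact K \<and> K \<subseteq> \<Omega> \<and> (\<forall>x. x \<notin> K \<longrightarrow> \<phi> x = 0)"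
proof (intro exI conjI)
  show "\<forall>x. x \<notin> closure {x. \<phi> x \<noteq> 0} \<longrightarrow> \<phi> x = 0"
    using closure_subset[of "{x. \<phi> x \<noteq> 0}"] by blast
qed (use assms in \<open>simp_all add: test_functions_def\<close>)

lemma test_function_C_k: "\<phi> \<in> test_functions \<Omega> \<Longrightarrow> C_k k \<phi>"
  by (simp add: test_functions_def)

lemma test_function_lincomb:
  assumes "\<phi> \<in> test_functions \<Omega>" "\<psi> \<in> test_functions \<Omega>"
  shows "(\<lambda>x. a * \<phi> x + b * \<psi> x) \<in> test_functions \<Omega>"
proof -
  obtain K where K: "compact K \<and> K \<subseteq> \<Omega> \<and> (\<forall>x. x \<notin> K \<longrightarrow> \<phi> x = 0)"
    using test_function_support[OF assms(1)] ..
  obtain L where L: "compact L \<and> L \<subseteq> \<Omega> \<and> (\<forall>x. x \<notin> L \<longrightarrow> \<psi> x = 0)"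
    using test_function_support[OF assms(2)] ..
  show ?thesis
  proof (rule test_functionsI)
    show "C_k k (\<lambda>x. a * \<phi> x + b * \<psi> x)" for k
      by (intro C_k_lincomb test_function_C_k[OF assms(1)] test_function_C_k[OF assms(2)])
    show "compact (K \<union> L)" "K \<union> L \<subseteq> \<Omega>" using K L by auto
    show "a * \<phi> x + b * \<psi> x = 0" if "x \<notin> K \<union> L" for x using K L that by simp
  qed
qed

lemma test_function_mult:
  assumes "\<phi> \<in> test_functions \<Omega>" "\<psi> \<in> test_functions \<Omega>"
  shows "(\<lambda>x. \<phi> x * \<psi> x) \<in> test_functions \<Omega>"
proof -
  obtain K where K: "compact K \<and> K \<subseteq> \<Omega> \<and> (\<forall>x. x \<notin> K \<longrightarrow> \<phi> x = 0)"
    using test_function_support[OF assms(1)] ..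
  show ?thesis
  proof (rule test_functionsI)
    show "C_k k (\<lambda>x. \<phi> x * \<psi> x)" for k
      by (intro C_k_mult test_function_C_k[OF assms(1)] test_function_C_k[OF assms(2)])
    show "\<phi> x * \<psi> x = 0" if "x \<notin> K" for x using K that by simp
  qed (use K in auto)
qed

lemma test_function_partial:
  assumes "\<phi> \<in> test_functions \<Omega>"
  shows "partial j \<phi> \<in> test_functions \<Omega>"
proof -
  obtain K where K: "compact K \<and> K \<subseteq> \<Omega> \<and> (\<forall>x. x \<notin> K \<longrightarrow> \<phi> x = 0)"
    using test_function_support[OF assms(1)] ..
  then have "open (- K)" using compact_imp_closed by blast
  show ?thesis
  proof (rule test_functionsI)
    show "C_k k (partial j \<phi>)" for k
      using test_function_C_k[OF assms, of "Suc k"] unfolding C_k.simps by blast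
    show "partial j \<phi> x = 0" if "x \<notin> K" for x
    proof -
      have "(\<phi> has_derivative (\<lambda>_. 0)) (at x)"
      proof (rule has_derivative_transform_within_open[OF _ \<open>open (- K)\<close>])
        show "((\<lambda>_. 0) has_derivative (\<lambda>_. 0)) (at x)" by (rule has_derivative_const)
      qed (use K that in auto)
      from fun_cong[OF frechet_derivative_at[OF this], of "axis j 1"] show ?thesis
        unfolding partial_def by simp
    qed
  qed (use K in auto)
qed

lemma test_function_differentiable:
  assumes "\<phi> \<in> test_functions \<Omega>" shows "\<phi> differentiable (at x)"
  using test_function_C_k[OF assms, of "Suc 0"] unfolding C_k.simps by blast

lemma test_function_continuous:
  assumes "\<phi> \<in> test_functions \<Omega>" shows "continuous_on UNIV \<phi>"
  using test_function_C_k[OF assms, of 0] unfolding C_k.simps .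

lemma test_function_zero_outside:
  assumes "\<phi> \<in> test_functions \<Omega>" "x \<notin> \<Omega>" shows "\<phi> x = 0"
  using test_function_support[OF assms(1)] assms(2) by blast

lemma test_function_bounded_support:
  assumes "\<phi> \<in> test_functions \<Omega>"
  shows "\<exists>R>0. \<forall>x. norm x > R \<longrightarrow> \<phi> x = 0"
proof -
  obtain K where K: "compact K" "\<forall>x. x \<notin> K \<longrightarrow> \<phi> x = 0"
    using test_function_support[OF assms(1)] by blast
  obtain R where R: "R > 0" "\<forall>x\<in>K. norm x \<le> R"
    using compact_imp_bounded[OF K(1)] unfolding bounded_pos by blast
  then have "\<phi> x = 0" if "norm x > R" for x
    using K(2)[rule_format, of x] R(2) that by fastforce
  then show ?thesis using R(1) by blast
qed

lemma test_function_bounded: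
  assumes "\<phi> \<in> test_functions \<Omega>"
  shows "\<exists>B>0. \<forall>x. \<bar>\<phi> x\<bar> \<le> B"
proof -
  obtain K where K: "compact K" "\<forall>x. x \<notin> K \<longrightarrow> \<phi> x = 0"
    using test_function_support[OF assms(1)] by blast
  have "bounded (\<phi> ` K)"
    using K(1) test_function_continuous[OF assms]
    by (intro compact_imp_bounded compact_continuous_image) (auto intro: continuous_on_subset)
  then obtain B where B: "B > 0" "\<forall>x\<in>K. \<bar>\<phi> x\<bar> \<le> B"
    unfolding bounded_pos by auto
  have "\<bar>\<phi> x\<bar> \<le> B" for x
    using K(2)[rule_format, of x] B by (cases "x \<in> K") auto
  then show ?thesis using B(1) by blast
qed

lemma partial_along_axis:
  fixes \<phi> :: "real^'d \<Rightarrow> real"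
  assumes "\<And>x. \<phi> differentiable (at x)"
  shows "((\<lambda>s. \<phi> (p + s *\<^sub>R axis j 1)) has_real_derivative partial j \<phi> (p + s *\<^sub>R axis j 1)) (at s)"
proof -
  let ?D = "frechet_derivative \<phi> (at (p + s *\<^sub>R axis j 1))"
  have D: "(\<phi> has_derivative ?D) (at (p + s *\<^sub>R axis j 1))"
    using assms by (auto simp: frechet_derivative_works)
  have l: "((\<lambda>s. p + s *\<^sub>R axis j 1) has_derivative (\<lambda>h. h *\<^sub>R axis j 1)) (at s)"
    by (auto intro!: derivative_eq_intros)
  have "((\<lambda>s. \<phi> (p + s *\<^sub>R axis j 1)) has_derivative (\<lambda>h. ?D (h *\<^sub>R axis j 1))) (at s)"
    using has_derivative_compose[OF l D] by simp
  moreover have "?D (h *\<^sub>R axis j 1) = partial j \<phi> (p + s *\<^sub>R axis j 1) * h" for h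
    using has_derivative_linear[OF D] by (simp add: linear_cmul partial_def)
  ultimately show ?thesis by (simp add: has_field_derivative_def mult_commute_abs)
qed

lemma test_function_integrable:
  fixes \<phi> :: "real^'d \<Rightarrow> real"
  assumes "\<phi> \<in> test_functions \<Omega>"
  shows "integrable lborel \<phi>"
proof -
  obtain K where K: "compact K" "\<forall>x. x \<notin> K \<longrightarrow> \<phi> x = 0"
    using test_function_support[OF assms(1)] by blast
  have "integrable lborel (\<lambda>x. indicator K x *\<^sub>R \<phi> x)"
    using K(1) test_function_continuous[OF assms]
    by (intro borel_integrable_compact) (auto intro: continuous_on_subset)
  moreover have "(\<lambda>x. indicator K x *\<^sub>R \<phi> x) = \<phi>"
    using K(2) by (auto simp: fun_eq_iff indicator_def)
  ultimately show ?thesis by simp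
qed

text \<open>Translation leaves the integral of \<open>\<phi>\<close> unchanged, so all difference quotients of \<open>\<phi>\<close> have
  integral zero; dominated convergence carries this to the derivative.\<close>

lemma integral_partial_test_function:
  fixes \<phi> :: "real^'d \<Rightarrow> real"
  assumes \<phi>: "\<phi> \<in> test_functions \<Omega>"
  shows "(LINT x|lborel. partial j \<phi> x) = 0"
proof -
  define e :: "real^'d" where "e = axis j 1"
  define h where "h n = 1 / real (Suc n)" for n
  have h: "h n > 0" "h n \<le> 1" for n by (auto simp: h_def)
  have h0: "h \<longlonglongrightarrow> 0" unfolding h_def by (rule LIMSEQ_Suc[OF lim_1_over_n])
  define s where "s n x = (\<phi> (x + h n *\<^sub>R e) - \<phi> x) / h n" for n x
  obtain R where R: "R > 0" "\<And>x. norm x > R \<Longrightarrow> \<phi> x = 0"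
    using test_function_bounded_support[OF \<phi>] by blast
  obtain B where B: "B > 0" "\<And>x. \<bar>partial j \<phi> x\<bar> \<le> B"
    using test_function_bounded[OF test_function_partial[OF \<phi>]] by blast
  note line = partial_along_axis[OF test_function_differentiable[OF \<phi>], of _ j, folded e_def]
  have [measurable]: "\<phi> \<in> borel_measurable borel" "partial j \<phi> \<in> borel_measurable borel"
    using test_function_continuous[OF \<phi>] test_function_continuous[OF test_function_partial[OF \<phi>]]
    by (auto intro: borel_measurable_continuous_onI)
  have int: "integrable lborel \<phi>" by (rule test_function_integrable[OF \<phi>])
  have shift: "integrable lborel (\<lambda>x. \<phi> (x + c))" "(LINT x|lborel. \<phi> (x + c)) = (LINT x|lborel. \<phi> x)" for c
  proof -
    have "integrable (distr lborel borel ((+) c)) \<phi>" using int by (simp add: lborel_distr_plus)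
    then show "integrable lborel (\<lambda>x. \<phi> (x + c))"
      by (simp add: integrable_distr_eq add.commute)
    have "(LINT x|lborel. \<phi> x) = (LINT x|distr lborel borel ((+) c). \<phi> x)"
      by (simp add: lborel_distr_plus)
    also have "\<dots> = (LINT x|lborel. \<phi> (x + c))" by (simp add: integral_distr add.commute)
    finally show "(LINT x|lborel. \<phi> (x + c)) = (LINT x|lborel. \<phi> x)" by simp
  qed
  have s0: "(LINT x|lborel. s n x) = 0" for n
    using shift(1)[of "h n *\<^sub>R e"] int shift(2)[of "h n *\<^sub>R e"] by (simp add: s_def)
  have "(\<lambda>n. LINT x|lborel. s n x) \<longlonglongrightarrow> (LINT x|lborel. partial j \<phi> x)"
  proof (rule integral_dominated_convergence[where w="\<lambda>x. indicator (cball 0 (R+1)) x *\<^sub>R B"])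
    have "integrable lborel (indicator (cball (0::real^'d) (R + 1)) :: _ \<Rightarrow> real)"
      using emeasure_bounded_finite[of "cball (0::real^'d) (R+1)"] by (intro integrable_real_indicator) auto
    then show "integrable lborel (\<lambda>x::real^'d. indicator (cball 0 (R + 1)) x *\<^sub>R B)"
      by (rule integrable_scaleR_left)
    show "AE x in lborel. (\<lambda>n. s n x) \<longlonglongrightarrow> partial j \<phi> x"
    proof (rule AE_I2)
      fix x
      have "((\<lambda>t. (\<phi> (x + t *\<^sub>R e) - \<phi> x) / t) \<longlongrightarrow> partial j \<phi> x) (at 0)"
        using line[of x 0] unfolding DERIV_def by simp
      moreover have "filterlim h (at 0) sequentially"
        using h0 h(1) by (auto simp: filterlim_at less_imp_neq intro!: always_eventually) (metis less_irrefl)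
      ultimately show "(\<lambda>n. s n x) \<longlonglongrightarrow> partial j \<phi> x"
        unfolding s_def by (rule filterlim_compose)
    qed
    show "AE x in lborel. norm (s n x) \<le> indicator (cball 0 (R+1)) x *\<^sub>R B" for n
    proof (rule AE_I2)
      fix x :: "real^'d"
      show "norm (s n x) \<le> indicator (cball 0 (R+1)) x *\<^sub>R B"
      proof (cases "x \<in> cball 0 (R+1)")
        case True
        have "\<exists>z. 0 < z \<and> z < h n \<and> \<phi> (x + h n *\<^sub>R e) - \<phi> (x + 0 *\<^sub>R e) = (h n - 0) * partial j \<phi> (x + z *\<^sub>R e)"
          by (rule MVT2) (use h line in auto)
        then obtain z where "s n x = partial j \<phi> (x + z *\<^sub>R e)"
          using h(1)[of n] by (auto simp: s_def)
        then show ?thesis using B True by simp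
      next
        case False
        then have x: "norm x > R + 1" by simp
        have "norm x \<le> norm (x + h n *\<^sub>R e) + norm (h n *\<^sub>R e)"
          by (metis add_diff_cancel norm_triangle_ineq4)
        moreover have "norm (h n *\<^sub>R e) \<le> 1" using h[of n] by (simp add: e_def)
        ultimately have "norm (x + h n *\<^sub>R e) > R" using x by linarith
        then show ?thesis using R x by (simp add: s_def)
      qed
    qed
  qed (simp_all add: s_def)
  then show ?thesis using s0 LIMSEQ_unique by (simp add: LIMSEQ_const_iff)
qed

section \<open>Ladyzhenskaya's inequality\<close>

text \<open>The fundamental theorem of calculus, started at a point to the left of the support of \<open>h\<close>.\<close>

lemma abs_le_nn_integral_deriv:
  fixes h h' :: "real \<Rightarrow> real"
  assumes deriv: "\<And>s. (h has_real_derivative h' s) (at s)"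
    and cont: "continuous_on UNIV h'"
    and supp: "\<And>s. \<bar>s\<bar> > R \<Longrightarrow> h s = 0"
  shows "ennreal \<bar>h x\<bar> \<le> (\<integral>\<^sup>+s. ennreal \<bar>h' s\<bar> \<partial>lborel)"
proof (cases "\<bar>x\<bar> > R")
  case True
  then show ?thesis using supp by simp
next
  case False
  define a where "a = - \<bar>R\<bar> - 1"
  have a: "a \<le> x" "h a = 0" using False supp by (auto simp: a_def)
  have [measurable]: "h' \<in> borel_measurable borel"
    using cont by (rule borel_measurable_continuous_onI)
  have isc: "isCont h' s" for s using cont by (simp add: continuous_on_eq_continuous_at)
  have "has_bochner_integral lborel (\<lambda>s. h' s * indicator {a..x} s) (h x - h a)"
    using a deriv isc by (intro has_bochner_integral_FTC_Icc_real) auto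
  then have "integrable lborel (\<lambda>s. h' s * indicator {a..x} s)"
      "(LINT s|lborel. h' s * indicator {a..x} s) = h x"
    using a by (auto simp: has_bochner_integral_iff)
  then have "ennreal \<bar>h x\<bar> \<le> (\<integral>\<^sup>+s. norm (h' s * indicator {a..x} s) \<partial>lborel)"
    by (metis integral_norm_bound_ennreal real_norm_def)
  also have "\<dots> \<le> (\<integral>\<^sup>+s. ennreal \<bar>h' s\<bar> \<partial>lborel)"
    by (intro nn_integral_mono ennreal_leI) (auto simp: indicator_def)
  finally show ?thesis .
qed

text \<open>This combines two Cauchy-Schwarz estimates of the form \<open>a\<^sup>2 \<le> K\<close> without taking square roots.\<close>

lemma ennreal_mult_le_of_squares:
  fixes a b K :: ennreal
  assumes "a\<^sup>2 \<le> K" "b\<^sup>2 \<le> K"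
  shows "a * b \<le> K"
proof (cases "a \<le> b")
  case True
  then have "a * b \<le> b * b" by (intro mult_right_mono) auto
  then show ?thesis using assms(2) by (simp add: power2_eq_square)
next
  case False
  then have "a * b \<le> a * a" by (intro mult_left_mono) auto
  then show ?thesis using assms(1) by (simp add: power2_eq_square)
qed

text \<open>The square of \<open>F\<close> is bounded by a function of \<open>y\<close> alone and by a function of \<open>x\<close> alone (by
  integrating \<open>\<partial>(F\<^sup>2)\<close> along a line in either direction), hence \<open>F\<^sup>4\<close> by their product.\<close>

lemma planar_fourth_power_bound:
  fixes F F1 F2 :: "real \<times> real \<Rightarrow> real"
  assumes cont: "continuous_on UNIV F" "continuous_on UNIV F1" "continuous_on UNIV F2"
    and d1: "\<And>x y. ((\<lambda>x. F (x, y)) has_real_derivative F1 (x, y)) (at x)"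
    and d2: "\<And>x y. ((\<lambda>y. F (x, y)) has_real_derivative F2 (x, y)) (at y)"
    and supp: "\<And>x y. \<bar>x\<bar> > R \<or> \<bar>y\<bar> > R \<Longrightarrow> F (x, y) = 0"
  shows "(\<integral>\<^sup>+p. ennreal (F p ^ 4) \<partial>lborel) \<le>
         (\<integral>\<^sup>+p. ennreal \<bar>2 * F p * F1 p\<bar> \<partial>lborel) * (\<integral>\<^sup>+p. ennreal \<bar>2 * F p * F2 p\<bar> \<partial>lborel)"
proof -
  have [measurable]: "F \<in> borel_measurable (lborel \<Otimes>\<^sub>M lborel)" "F1 \<in> borel_measurable (lborel \<Otimes>\<^sub>M lborel)"
      "F2 \<in> borel_measurable (lborel \<Otimes>\<^sub>M lborel)"
    using cont by (simp_all add: lborel_prod borel_measurable_continuous_onI)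
  have [measurable]: "F \<in> borel_measurable borel" "F1 \<in> borel_measurable borel" "F2 \<in> borel_measurable borel"
    using cont by (simp_all add: borel_measurable_continuous_onI)
  define A where "A y = (\<integral>\<^sup>+x. ennreal \<bar>2 * F (x, y) * F1 (x, y)\<bar> \<partial>lborel)" for y
  define B where "B x = (\<integral>\<^sup>+y. ennreal \<bar>2 * F (x, y) * F2 (x, y)\<bar> \<partial>lborel)" for x
  have [measurable]: "A \<in> borel_measurable lborel" "B \<in> borel_measurable lborel"
    unfolding A_def B_def by measurable
  have A: "ennreal (F (x, y) ^ 2) \<le> A y" for x y
  proof -
    have "ennreal \<bar>F (x, y) ^ 2\<bar> \<le> (\<integral>\<^sup>+s. ennreal \<bar>2 * F (s, y) * F1 (s, y)\<bar> \<partial>lborel)"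
    proof (rule abs_le_nn_integral_deriv[where h="\<lambda>s. (F (s, y))\<^sup>2"])
      show "((\<lambda>s. (F (s, y))\<^sup>2) has_real_derivative 2 * F (s, y) * F1 (s, y)) (at s)" for s
        using d1 by (auto intro!: derivative_eq_intros)
      show "continuous_on UNIV (\<lambda>s. 2 * F (s, y) * F1 (s, y))"
        by (intro continuous_intros continuous_on_compose2[OF cont(1)] continuous_on_compose2[OF cont(2)]) auto
      show "(F (s, y))\<^sup>2 = 0" if "\<bar>s\<bar> > R" for s using supp that by simp
    qed
    then show ?thesis by (simp add: A_def)
  qed
  have B: "ennreal (F (x, y) ^ 2) \<le> B x" for x y
  proof -
    have "ennreal \<bar>F (x, y) ^ 2\<bar> \<le> (\<integral>\<^sup>+s. ennreal \<bar>2 * F (x, s) * F2 (x, s)\<bar> \<partial>lborel)"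
    proof (rule abs_le_nn_integral_deriv[where h="\<lambda>s. (F (x, s))\<^sup>2"])
      show "((\<lambda>s. (F (x, s))\<^sup>2) has_real_derivative 2 * F (x, s) * F2 (x, s)) (at s)" for s
        using d2 by (auto intro!: derivative_eq_intros)
      show "continuous_on UNIV (\<lambda>s. 2 * F (x, s) * F2 (x, s))"
        by (intro continuous_intros continuous_on_compose2[OF cont(1)] continuous_on_compose2[OF cont(3)]) auto
      show "(F (x, s))\<^sup>2 = 0" if "\<bar>s\<bar> > R" for s using supp that by simp
    qed
    then show ?thesis by (simp add: B_def)
  qed
  have "(\<integral>\<^sup>+p. ennreal (F p ^ 4) \<partial>lborel) = (\<integral>\<^sup>+x. \<integral>\<^sup>+y. ennreal (F (x, y) ^ 4) \<partial>lborel \<partial>lborel)"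
    by (subst lborel.nn_integral_fst) (auto simp: lborel_prod)
  also have "\<dots> \<le> (\<integral>\<^sup>+x. \<integral>\<^sup>+y. B x * A y \<partial>lborel \<partial>lborel)"
  proof (intro nn_integral_mono)
    fix x y
    have "ennreal (F (x, y) ^ 4) = ennreal (F (x, y) ^ 2) * ennreal (F (x, y) ^ 2)"
      by (simp flip: ennreal_mult power_add)
    also have "\<dots> \<le> B x * A y" by (intro mult_mono A B) auto
    finally show "ennreal (F (x, y) ^ 4) \<le> B x * A y" .
  qed
  also have "\<dots> = (\<integral>\<^sup>+y. A y \<partial>lborel) * (\<integral>\<^sup>+x. B x \<partial>lborel)"
    by (simp add: nn_integral_cmult nn_integral_multc mult.commute)
  also have "(\<integral>\<^sup>+y. A y \<partial>lborel) = (\<integral>\<^sup>+p. ennreal \<bar>2 * F p * F1 p\<bar> \<partial>lborel)"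
    unfolding A_def by (subst lborel_pair.nn_integral_snd) (auto simp: lborel_prod)
  also have "(\<integral>\<^sup>+x. B x \<partial>lborel) = (\<integral>\<^sup>+p. ennreal \<bar>2 * F p * F2 p\<bar> \<partial>lborel)"
    unfolding B_def by (subst lborel.nn_integral_fst) (auto simp: lborel_prod)
  finally show ?thesis .
qed

lemma prod_Basis_vec:
  fixes w :: "real^'d"
  shows "(\<Prod>b\<in>Basis. w \<bullet> b) = (\<Prod>i\<in>UNIV. w $ i)"
proof -
  have "(Basis :: (real^'d) set) = range (\<lambda>i. axis i 1)" by (auto simp: Basis_vec_def)
  moreover have "inj (\<lambda>i::'d. axis i (1::real))" by (auto simp: inj_on_def axis_eq_axis)
  ultimately show ?thesis
    using prod.reindex[of "\<lambda>i::'d. axis i (1::real)" UNIV "\<lambda>b. w \<bullet> b"]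
    by (simp add: cart_eq_inner_axis o_def)
qed

lemma box_vec_eq: "box l u = {x::real^'d. \<forall>i. l $ i < x $ i \<and> x $ i < u $ i}"
  by (auto simp: mem_box_cart)

text \<open>Fubini's theorem is about binary products, whereas \<open>real^'d\<close> has an abstract index type.  When \<open>i\<close>, \<open>j\<close>
  (and \<open>k\<close>, for \<open>spatial\<close> below) enumerate that type, these maps are measure-preserving coordinates.\<close>

definition plane :: "'d \<Rightarrow> 'd \<Rightarrow> real \<times> real \<Rightarrow> real^'d" where
  "plane i j p = fst p *\<^sub>R axis i 1 + snd p *\<^sub>R axis j 1"

lemma continuous_on_plane: "continuous_on UNIV (plane i j)"
  unfolding plane_def by (intro continuous_intros)

lemma distr_lborel_plane:
  fixes i j :: "'d::finite"
  assumes ij: "i \<noteq> j" "UNIV = {i, j}"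
  shows "distr lborel borel (plane i j) = (lborel :: (real^'d) measure)"
proof (rule lborel_eqI[symmetric])
  have [measurable]: "plane i j \<in> borel_measurable borel"
    by (rule borel_measurable_continuous_onI[OF continuous_on_plane])
  have all: "(\<forall>k. P k) \<longleftrightarrow> P i \<and> P j" for P using ij by (metis UNIV_I insertE singletonD)
  fix l u :: "real^'d" assume "\<And>b. b \<in> Basis \<Longrightarrow> l \<bullet> b \<le> u \<bullet> b"
  then have le: "l $ k \<le> u $ k" for k by (simp add: cart_eq_inner_axis)
  have "plane i j -` box l u = {l $ i<..<u $ i} \<times> {l $ j<..<u $ j}"
    using ij(1) by (auto simp: plane_def box_vec_eq all axis_def)
  then have "emeasure (distr lborel borel (plane i j)) (box l u) =
      emeasure (lborel \<Otimes>\<^sub>M lborel) ({l $ i<..<u $ i} \<times> {l $ j<..<u $ j})"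
    by (simp add: emeasure_distr lborel_prod)
  also have "\<dots> = ennreal (u $ i - l $ i) * ennreal (u $ j - l $ j)"
    using le by (subst lborel.emeasure_pair_measure_Times) auto
  also have "\<dots> = ennreal (\<Prod>b\<in>Basis. (u - l) \<bullet> b)"
    unfolding prod_Basis_vec ij(2) using ij(1) le by (simp add: ennreal_mult)
  finally show "emeasure (distr lborel borel (plane i j)) (box l u) = ennreal (\<Prod>b\<in>Basis. (u - l) \<bullet> b)" .
qed simp

definition spatial :: "'d \<Rightarrow> 'd \<Rightarrow> 'd \<Rightarrow> (real \<times> real) \<times> real \<Rightarrow> real^'d" where
  "spatial i j k p = plane i j (fst p) + snd p *\<^sub>R axis k 1"

lemma continuous_on_spatial: "continuous_on UNIV (spatial i j k)"
  unfolding spatial_def plane_def by (intro continuous_intros)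

lemma distr_lborel_spatial:
  fixes i j k :: "'d::finite"
  assumes ijk: "i \<noteq> j" "i \<noteq> k" "j \<noteq> k" "UNIV = {i, j, k}"
  shows "distr lborel borel (spatial i j k) = (lborel :: (real^'d) measure)"
proof (rule lborel_eqI[symmetric])
  have [measurable]: "spatial i j k \<in> borel_measurable borel"
    by (rule borel_measurable_continuous_onI[OF continuous_on_spatial])
  have all: "(\<forall>m. P m) \<longleftrightarrow> P i \<and> P j \<and> P k" for P using ijk by (metis UNIV_I insertE singletonD)
  fix l u :: "real^'d" assume "\<And>b. b \<in> Basis \<Longrightarrow> l \<bullet> b \<le> u \<bullet> b"
  then have le: "l $ m \<le> u $ m" for m by (simp add: cart_eq_inner_axis)
  have "spatial i j k -` box l u = ({l $ i<..<u $ i} \<times> {l $ j<..<u $ j}) \<times> {l $ k<..<u $ k}"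
    using ijk(1-3) by (auto simp: spatial_def plane_def box_vec_eq all axis_def)
  then have "emeasure (distr lborel borel (spatial i j k)) (box l u) =
      emeasure ((lborel \<Otimes>\<^sub>M lborel) \<Otimes>\<^sub>M lborel) (({l $ i<..<u $ i} \<times> {l $ j<..<u $ j}) \<times> {l $ k<..<u $ k})"
    by (simp add: emeasure_distr lborel_prod)
  also have "\<dots> = ennreal (u $ i - l $ i) * ennreal (u $ j - l $ j) * ennreal (u $ k - l $ k)"
    using le by (subst lborel.emeasure_pair_measure_Times; (subst lborel.emeasure_pair_measure_Times)?) auto
  also have "\<dots> = ennreal (\<Prod>b\<in>Basis. (u - l) \<bullet> b)"
    unfolding prod_Basis_vec ijk(4) using ijk(1-3) le by (simp add: ennreal_mult mult.assoc)
  finally show "emeasure (distr lborel borel (spatial i j k)) (box l u) = ennreal (\<Prod>b\<in>Basis. (u - l) \<bullet> b)" .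
qed simp


lemma partial_sq_le_norm: "(partial j \<phi> x)\<^sup>2 \<le> (norm (\<chi> j. partial j \<phi> x))\<^sup>2"
proof -
  have "\<bar>(\<chi> j. partial j \<phi> x) $ j\<bar> \<le> norm (\<chi> j. partial j \<phi> x)" by (rule component_le_norm_cart)
  then have "\<bar>partial j \<phi> x\<bar>\<^sup>2 \<le> (norm (\<chi> j. partial j \<phi> x))\<^sup>2" by (intro power_mono) auto
  then show ?thesis by simp
qed

lemma abs_two_mult_partial_le:
  "\<bar>2 * \<phi> x * partial j \<phi> x\<bar> \<le> (\<phi> x)\<^sup>2 + (norm (\<chi> j. partial j \<phi> x))\<^sup>2"
proof -
  have "\<bar>2 * \<phi> x * partial j \<phi> x\<bar> \<le> (\<phi> x)\<^sup>2 + (partial j \<phi> x)\<^sup>2"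
    using sum_squares_bound[of "\<bar>\<phi> x\<bar>" "\<bar>partial j \<phi> x\<bar>"] by (simp add: abs_mult)
  then show ?thesis using partial_sq_le_norm[of j \<phi> x] by linarith
qed

lemma test_function_grad_measurable:
  assumes "\<phi> \<in> test_functions \<Omega>"
  shows "(\<lambda>x. \<chi> j. partial j \<phi> x) \<in> borel_measurable borel"
  by (intro borel_measurable_continuous_onI continuous_on_vec_lambda
      test_function_continuous[OF test_function_partial[OF assms]])

text \<open>The planar bound, with \<open>\<bar>2 \<phi> \<partial>\<phi>\<bar> \<le> \<phi>\<^sup>2 + \<bar>\<nabla>\<phi>\<bar>\<^sup>2\<close> in both factors.\<close>

lemma Ladyzhenskaya_plane:
  fixes \<phi> :: "real^'d \<Rightarrow> real"
  assumes \<phi>: "\<phi> \<in> test_functions \<Omega>" and d: "CARD('d) = 2"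
  shows "(\<integral>\<^sup>+x. ennreal (\<phi> x ^ 4) \<partial>lborel) \<le>
         (\<integral>\<^sup>+x. ennreal ((\<phi> x)\<^sup>2 + (norm (\<chi> j. partial j \<phi> x))\<^sup>2) \<partial>lborel)\<^sup>2" (is "_ \<le> ?N\<^sup>2")
proof -
  obtain i j :: 'd where ij: "UNIV = {i, j}" "i \<noteq> j" using d by (auto simp: card_2_iff)
  let ?T = "plane i j"
  have [measurable]: "?T \<in> borel_measurable borel"
    by (rule borel_measurable_continuous_onI[OF continuous_on_plane])
  have [measurable]: "\<phi> \<in> borel_measurable borel" "partial k \<phi> \<in> borel_measurable borel" for k
    using test_function_continuous[OF \<phi>] test_function_continuous[OF test_function_partial[OF \<phi>]]
    by (auto intro: borel_measurable_continuous_onI)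
  have I: "(\<integral>\<^sup>+x. f x \<partial>lborel) = (\<integral>\<^sup>+p. f (?T p) \<partial>lborel)"
    if [measurable]: "f \<in> borel_measurable borel" for f :: "real^'d \<Rightarrow> ennreal"
    using nn_integral_distr[of ?T lborel borel f] by (simp add: distr_lborel_plane[OF ij(2,1)])
  have cont: "continuous_on UNIV (\<lambda>p. \<phi> (?T p))" "continuous_on UNIV (\<lambda>p. partial k \<phi> (?T p))" for k
    using test_function_continuous[OF \<phi>] test_function_continuous[OF test_function_partial[OF \<phi>]]
    by (auto intro: continuous_on_compose2[OF _ continuous_on_plane])
  obtain R where R: "R > 0" "\<And>x. norm x > R \<Longrightarrow> \<phi> x = 0"
    using test_function_bounded_support[OF \<phi>] by blast
  have half: "(\<integral>\<^sup>+p. ennreal \<bar>2 * \<phi> (?T p) * partial k \<phi> (?T p)\<bar> \<partial>lborel) \<le> ?N" for k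
    by (subst I[symmetric], measurable) (intro nn_integral_mono ennreal_leI abs_two_mult_partial_le)
  have "(\<integral>\<^sup>+x. ennreal (\<phi> x ^ 4) \<partial>lborel) = (\<integral>\<^sup>+p. ennreal (\<phi> (?T p) ^ 4) \<partial>lborel)"
    by (rule I) measurable
  also have "\<dots> \<le> (\<integral>\<^sup>+p. ennreal \<bar>2 * \<phi> (?T p) * partial i \<phi> (?T p)\<bar> \<partial>lborel) *
                  (\<integral>\<^sup>+p. ennreal \<bar>2 * \<phi> (?T p) * partial j \<phi> (?T p)\<bar> \<partial>lborel)"
  proof (rule planar_fourth_power_bound[OF cont(1) cont(2) cont(2)])
    show "((\<lambda>x. \<phi> (?T (x, y))) has_real_derivative partial i \<phi> (?T (x, y))) (at x)" for x y
      using partial_along_axis[OF test_function_differentiable[OF \<phi>], of "y *\<^sub>R axis j 1" i x]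
      by (simp add: plane_def add.commute)
    show "((\<lambda>y. \<phi> (?T (x, y))) has_real_derivative partial j \<phi> (?T (x, y))) (at y)" for x y
      using partial_along_axis[OF test_function_differentiable[OF \<phi>], of "x *\<^sub>R axis i 1" j y]
      by (simp add: plane_def)
    show "\<phi> (?T (x, y)) = 0" if "\<bar>x\<bar> > R \<or> \<bar>y\<bar> > R" for x y
    proof -
      have "?T (x, y) $ i = x" "?T (x, y) $ j = y" using ij(2) by (auto simp: plane_def axis_def)
      then have "\<bar>x\<bar> \<le> norm (?T (x, y))" "\<bar>y\<bar> \<le> norm (?T (x, y))"
        using component_le_norm_cart by metis+
      then show ?thesis using that R(2) by fastforce
    qed
  qed
  also have "\<dots> \<le> ?N * ?N" by (intro mult_mono half) auto
  finally show ?thesis by (simp add: power2_eq_square)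
qed

text \<open>On each plane \<open>t = const\<close> the planar bound and the Cauchy-Schwarz inequality give
  \<open>\<integral> \<phi>\<^sup>4 \<le> 4 (\<integral> \<phi>\<^sup>2) (\<integral> \<bar>\<nabla>\<phi>\<bar>\<^sup>2)\<close>; the first factor is bounded uniformly in \<open>t\<close> by integrating
  \<open>\<partial>(\<phi>\<^sup>2)\<close> along the third axis, and the second one is integrable in \<open>t\<close>.\<close>

lemma Ladyzhenskaya_space:
  fixes \<phi> :: "real^'d \<Rightarrow> real"
  assumes \<phi>: "\<phi> \<in> test_functions \<Omega>" and d: "CARD('d) = 3"
  shows "(\<integral>\<^sup>+x. ennreal (\<phi> x ^ 4) \<partial>lborel) \<le>
         4 * (\<integral>\<^sup>+x. ennreal ((\<phi> x)\<^sup>2 + (norm (\<chi> j. partial j \<phi> x))\<^sup>2) \<partial>lborel)\<^sup>2" (is "_ \<le> 4 * ?N\<^sup>2")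
proof -
  obtain i j k :: 'd where ijk: "UNIV = {i, j, k}" "i \<noteq> j" "j \<noteq> k" "i \<noteq> k"
    using d by (auto simp: card_3_iff)
  let ?T = "spatial i j k"
  have [measurable]: "?T \<in> borel_measurable (lborel \<Otimes>\<^sub>M lborel)"
    using borel_measurable_continuous_onI[OF continuous_on_spatial] by (simp add: lborel_prod)
  have [measurable]: "\<phi> \<in> borel_measurable borel" "partial m \<phi> \<in> borel_measurable borel"
      "(\<lambda>x. \<chi> j. partial j \<phi> x) \<in> borel_measurable borel" for m
    using test_function_continuous[OF \<phi>] test_function_continuous[OF test_function_partial[OF \<phi>]]
      test_function_grad_measurable[OF \<phi>]
    by (auto intro: borel_measurable_continuous_onI)
  have I: "(\<integral>\<^sup>+x. f x \<partial>lborel) = (\<integral>\<^sup>+p. f (?T p) \<partial>(lborel \<Otimes>\<^sub>M lborel))"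
    if [measurable]: "f \<in> borel_measurable borel" for f :: "real^'d \<Rightarrow> ennreal"
    using nn_integral_distr[of ?T lborel borel f] distr_lborel_spatial[OF ijk(2,4,3,1)]
      borel_measurable_continuous_onI[OF continuous_on_spatial, of i j k]
    by (simp add: lborel_prod)
  have over_slices: "(\<integral>\<^sup>+t. \<integral>\<^sup>+p. f (?T (p, t)) \<partial>lborel \<partial>lborel) = (\<integral>\<^sup>+x. f x \<partial>lborel)"
    if [measurable]: "f \<in> borel_measurable borel" for f :: "real^'d \<Rightarrow> ennreal"
    using lborel_pair.nn_integral_snd[of "\<lambda>p. f (?T p)"] I[OF that] by simp
  have over_lines: "(\<integral>\<^sup>+p. \<integral>\<^sup>+t. f (?T (p, t)) \<partial>lborel \<partial>lborel) = (\<integral>\<^sup>+x. f x \<partial>lborel)"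
    if [measurable]: "f \<in> borel_measurable borel" for f :: "real^'d \<Rightarrow> ennreal"
    using lborel.nn_integral_fst[of "\<lambda>p. f (?T p)" lborel] I[OF that] by simp
  obtain R where R: "R > 0" "\<And>x. norm x > R \<Longrightarrow> \<phi> x = 0"
    using test_function_bounded_support[OF \<phi>] by blast
  have coord: "?T ((x, y), t) $ i = x" "?T ((x, y), t) $ j = y" "?T ((x, y), t) $ k = t" for x y t
    using ijk(2-4) by (auto simp: spatial_def plane_def axis_def)
  have supp: "\<phi> (?T ((x, y), t)) = 0" if "\<bar>x\<bar> > R \<or> \<bar>y\<bar> > R \<or> \<bar>t\<bar> > R" for x y t
  proof -
    have "\<bar>x\<bar> \<le> norm (?T ((x, y), t))" "\<bar>y\<bar> \<le> norm (?T ((x, y), t))" "\<bar>t\<bar> \<le> norm (?T ((x, y), t))"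
      using component_le_norm_cart coord by metis+
    then show ?thesis using that R(2) by fastforce
  qed
  have cont1: "continuous_on UNIV (\<lambda>p. ?T (p, t))" for t
    by (intro continuous_on_compose2[OF continuous_on_spatial] continuous_intros) auto
  have cont2: "continuous_on UNIV (\<lambda>t. ?T (p, t))" for p
    by (intro continuous_on_compose2[OF continuous_on_spatial] continuous_intros) auto
  have cont: "continuous_on UNIV \<phi>" "continuous_on UNIV (partial m \<phi>)" for m
    using test_function_continuous[OF \<phi>] test_function_continuous[OF test_function_partial[OF \<phi>]] by auto
  \<comment> \<open>The planar bound is applied to the slices with the third coordinate fixed to \<open>t\<close>.\<close>
  define P where "P t = (\<integral>\<^sup>+p. ennreal ((norm (\<chi> j. partial j \<phi> (?T (p, t))))\<^sup>2) \<partial>lborel)" for t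
  have [measurable]: "P \<in> borel_measurable lborel" unfolding P_def by measurable
  have P: "(\<integral>\<^sup>+t. P t \<partial>lborel) \<le> ?N"
    unfolding P_def by (subst over_slices, measurable) (intro nn_integral_mono ennreal_leI, simp)
  have S: "(\<integral>\<^sup>+p. ennreal ((\<phi> (?T (p, t)))\<^sup>2) \<partial>lborel) \<le> ?N" for t
  proof -
    have "ennreal ((\<phi> (?T (p, t)))\<^sup>2) \<le> (\<integral>\<^sup>+s. ennreal \<bar>2 * \<phi> (?T (p, s)) * partial k \<phi> (?T (p, s))\<bar> \<partial>lborel)" for p
    proof -
      have "ennreal \<bar>(\<phi> (?T (p, t)))\<^sup>2\<bar> \<le> (\<integral>\<^sup>+s. ennreal \<bar>2 * \<phi> (?T (p, s)) * partial k \<phi> (?T (p, s))\<bar> \<partial>lborel)"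
      proof (rule abs_le_nn_integral_deriv[where h="\<lambda>s. (\<phi> (?T (p, s)))\<^sup>2"])
        have "((\<lambda>s. \<phi> (?T (p, s))) has_real_derivative partial k \<phi> (?T (p, s))) (at s)" for s
          using partial_along_axis[OF test_function_differentiable[OF \<phi>], of "plane i j p" k s]
          by (simp add: spatial_def)
        then show "((\<lambda>s. (\<phi> (?T (p, s)))\<^sup>2) has_real_derivative 2 * \<phi> (?T (p, s)) * partial k \<phi> (?T (p, s))) (at s)" for s
          by (auto intro!: derivative_eq_intros)
        show "continuous_on UNIV (\<lambda>s. 2 * \<phi> (?T (p, s)) * partial k \<phi> (?T (p, s)))"
          by (intro continuous_intros continuous_on_compose2[OF cont(1) cont2] continuous_on_compose2[OF cont(2) cont2]) auto
        show "(\<phi> (?T (p, s)))\<^sup>2 = 0" if "\<bar>s\<bar> > R" for s using supp[of "fst p" "snd p" s] that by simp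
      qed
      then show ?thesis by simp
    qed
    then have "(\<integral>\<^sup>+p. ennreal ((\<phi> (?T (p, t)))\<^sup>2) \<partial>lborel) \<le>
        (\<integral>\<^sup>+p. \<integral>\<^sup>+s. ennreal \<bar>2 * \<phi> (?T (p, s)) * partial k \<phi> (?T (p, s))\<bar> \<partial>lborel \<partial>lborel)"
      by (intro nn_integral_mono)
    also have "\<dots> = (\<integral>\<^sup>+x. ennreal \<bar>2 * \<phi> x * partial k \<phi> x\<bar> \<partial>lborel)"
      by (rule over_lines) measurable
    also have "\<dots> \<le> ?N" by (intro nn_integral_mono ennreal_leI abs_two_mult_partial_le)
    finally show ?thesis .
  qed
  have half: "(\<integral>\<^sup>+p. ennreal \<bar>2 * \<phi> (?T (p, t)) * partial m \<phi> (?T (p, t))\<bar> \<partial>lborel)\<^sup>2 \<le> 4 * ?N * P t" for m t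
  proof -
    have [measurable]: "(\<lambda>p. ?T (p, t)) \<in> borel_measurable borel"
      by (rule borel_measurable_continuous_onI[OF cont1])
    have "(\<integral>\<^sup>+p. (ennreal \<bar>2 * \<phi> (?T (p, t))\<bar>)\<^sup>2 \<partial>lborel) = (\<integral>\<^sup>+p. 4 * ennreal ((\<phi> (?T (p, t)))\<^sup>2) \<partial>lborel)"
      by (intro nn_integral_cong) (simp add: ennreal_power power_mult_distrib ennreal_mult)
    also have "\<dots> = 4 * (\<integral>\<^sup>+p. ennreal ((\<phi> (?T (p, t)))\<^sup>2) \<partial>lborel)"
      by (rule nn_integral_cmult) measurable
    also have "\<dots> \<le> 4 * ?N" by (intro mult_left_mono S) auto
    finally have first: "(\<integral>\<^sup>+p. (ennreal \<bar>2 * \<phi> (?T (p, t))\<bar>)\<^sup>2 \<partial>lborel) \<le> 4 * ?N" .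
    have second: "(\<integral>\<^sup>+p. (ennreal \<bar>partial m \<phi> (?T (p, t))\<bar>)\<^sup>2 \<partial>lborel) \<le> P t"
      unfolding P_def by (intro nn_integral_mono) (simp add: ennreal_power ennreal_leI partial_sq_le_norm)
    have "(\<integral>\<^sup>+p. ennreal \<bar>2 * \<phi> (?T (p, t)) * partial m \<phi> (?T (p, t))\<bar> \<partial>lborel)\<^sup>2 =
        (\<integral>\<^sup>+p. ennreal \<bar>2 * \<phi> (?T (p, t))\<bar> * ennreal \<bar>partial m \<phi> (?T (p, t))\<bar> \<partial>lborel)\<^sup>2"
      by (simp add: abs_mult ennreal_mult)
    also have "\<dots> \<le> (\<integral>\<^sup>+p. (ennreal \<bar>2 * \<phi> (?T (p, t))\<bar>)\<^sup>2 \<partial>lborel) * (\<integral>\<^sup>+p. (ennreal \<bar>partial m \<phi> (?T (p, t))\<bar>)\<^sup>2 \<partial>lborel)"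
      by (rule Cauchy_Schwarz_nn_integral) measurable
    also have "\<dots> \<le> 4 * ?N * P t" by (intro mult_mono first second) auto
    finally show ?thesis .
  qed
  have slice: "(\<integral>\<^sup>+p. ennreal (\<phi> (?T (p, t)) ^ 4) \<partial>lborel) \<le> 4 * ?N * P t" for t
  proof -
    have "(\<integral>\<^sup>+p. ennreal (\<phi> (?T (p, t)) ^ 4) \<partial>lborel) \<le>
      (\<integral>\<^sup>+p. ennreal \<bar>2 * \<phi> (?T (p, t)) * partial i \<phi> (?T (p, t))\<bar> \<partial>lborel) *
      (\<integral>\<^sup>+p. ennreal \<bar>2 * \<phi> (?T (p, t)) * partial j \<phi> (?T (p, t))\<bar> \<partial>lborel)"
    proof (rule planar_fourth_power_bound)
      show "continuous_on UNIV (\<lambda>p. \<phi> (?T (p, t)))" "continuous_on UNIV (\<lambda>p. partial i \<phi> (?T (p, t)))"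
          "continuous_on UNIV (\<lambda>p. partial j \<phi> (?T (p, t)))"
        by (auto intro: continuous_on_compose2[OF cont(1) cont1] continuous_on_compose2[OF cont(2) cont1])
      show "((\<lambda>x. \<phi> (?T ((x, y), t))) has_real_derivative partial i \<phi> (?T ((x, y), t))) (at x)" for x y
        using partial_along_axis[OF test_function_differentiable[OF \<phi>], of "y *\<^sub>R axis j 1 + t *\<^sub>R axis k 1" i x]
        by (simp add: spatial_def plane_def ac_simps)
      show "((\<lambda>y. \<phi> (?T ((x, y), t))) has_real_derivative partial j \<phi> (?T ((x, y), t))) (at y)" for x y
        using partial_along_axis[OF test_function_differentiable[OF \<phi>], of "x *\<^sub>R axis i 1 + t *\<^sub>R axis k 1" j y]
        by (simp add: spatial_def plane_def ac_simps)
      show "\<phi> (?T ((x, y), t)) = 0" if "\<bar>x\<bar> > R \<or> \<bar>y\<bar> > R" for x y using supp that by blast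
    qed
    also have "\<dots> \<le> 4 * ?N * P t" by (rule ennreal_mult_le_of_squares[OF half half])
    finally show ?thesis .
  qed
  have "(\<integral>\<^sup>+x. ennreal (\<phi> x ^ 4) \<partial>lborel) = (\<integral>\<^sup>+t. \<integral>\<^sup>+p. ennreal (\<phi> (?T (p, t)) ^ 4) \<partial>lborel \<partial>lborel)"
    by (rule over_slices[symmetric]) measurable
  also have "\<dots> \<le> (\<integral>\<^sup>+t. 4 * ?N * P t \<partial>lborel)" by (intro nn_integral_mono slice)
  also have "\<dots> = 4 * ?N * (\<integral>\<^sup>+t. P t \<partial>lborel)" by (rule nn_integral_cmult) measurable
  also have "\<dots> \<le> 4 * ?N * ?N" by (intro mult_left_mono P) auto
  finally show ?thesis by (simp add: power2_eq_square mult.assoc)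
qed

text \<open>The constant \<open>4\<close> is the one from three dimensions.  The inequality bounds the \<open>L\<^sup>4\<close> norm of
  a test function by its \<open>H\<^sup>1\<close> norm, which stays bounded along the approximating sequences of \<open>H\<^sup>1\<^sub>0\<close>.\<close>

lemma Ladyzhenskaya:
  fixes \<phi> :: "real^'d \<Rightarrow> real"
  assumes \<phi>: "\<phi> \<in> test_functions \<Omega>" and d: "CARD('d) = 2 \<or> CARD('d) = 3"
  shows "(\<integral>\<^sup>+x. ennreal (\<phi> x ^ 4) \<partial>lborel) \<le>
         4 * (\<integral>\<^sup>+x. ennreal ((\<phi> x)\<^sup>2 + (norm (\<chi> j. partial j \<phi> x))\<^sup>2) \<partial>lborel)\<^sup>2" (is "_ \<le> 4 * ?N\<^sup>2")
  using d
proof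
  assume "CARD('d) = 2"
  then have "(\<integral>\<^sup>+x. ennreal (\<phi> x ^ 4) \<partial>lborel) \<le> 1 * ?N\<^sup>2"
    using Ladyzhenskaya_plane[OF \<phi>] by simp
  also have "\<dots> \<le> 4 * ?N\<^sup>2" by (intro mult_right_mono) auto
  finally show ?thesis .
qed (rule Ladyzhenskaya_space[OF \<phi>])

section \<open>Square-integrable functions\<close>

lemma L2_spaceI:
  "u \<in> borel_measurable (lebesgue_on \<Omega>) \<Longrightarrow> integrable (lebesgue_on \<Omega>) (\<lambda>x. (norm (u x))\<^sup>2) \<Longrightarrow> u \<in> L2_space \<Omega>"
  by (simp add: L2_space_def)

lemma L2_space_measurable [measurable_dest]: "u \<in> L2_space \<Omega> \<Longrightarrow> u \<in> borel_measurable (lebesgue_on \<Omega>)"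
  by (simp add: L2_space_def)

lemma L2_space_integrable: "u \<in> L2_space \<Omega> \<Longrightarrow> integrable (lebesgue_on \<Omega>) (\<lambda>x. (norm (u x))\<^sup>2)"
  by (simp add: L2_space_def)

lemma L2_space_lincomb:
  assumes [measurable]: "u \<in> L2_space \<Omega>" "v \<in> L2_space \<Omega>"
  shows "(\<lambda>x. a *\<^sub>R u x + b *\<^sub>R v x) \<in> L2_space \<Omega>"
proof (rule L2_spaceI)
  show "integrable (lebesgue_on \<Omega>) (\<lambda>x. (norm (a *\<^sub>R u x + b *\<^sub>R v x))\<^sup>2)"
  proof (rule Bochner_Integration.integrable_bound)
    show "integrable (lebesgue_on \<Omega>) (\<lambda>x. 2 * a\<^sup>2 * (norm (u x))\<^sup>2 + 2 * b\<^sup>2 * (norm (v x))\<^sup>2)"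
      using assms[THEN L2_space_integrable] by (intro Bochner_Integration.integrable_add integrable_mult_right)
    have "(norm (a *\<^sub>R u x + b *\<^sub>R v x))\<^sup>2 \<le> 2 * a\<^sup>2 * (norm (u x))\<^sup>2 + 2 * b\<^sup>2 * (norm (v x))\<^sup>2" for x
    proof -
      have "(norm (a *\<^sub>R u x + b *\<^sub>R v x))\<^sup>2 \<le> (\<bar>a\<bar> * norm (u x) + \<bar>b\<bar> * norm (v x))\<^sup>2"
        using norm_triangle_ineq[of "a *\<^sub>R u x" "b *\<^sub>R v x"] by (intro power_mono) auto
      also have "\<dots> \<le> 2 * (\<bar>a\<bar> * norm (u x))\<^sup>2 + 2 * (\<bar>b\<bar> * norm (v x))\<^sup>2"
        using sum_squares_bound[of "\<bar>a\<bar> * norm (u x)" "\<bar>b\<bar> * norm (v x)"] by (simp add: power2_sum)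
      finally show ?thesis by (simp add: power_mult_distrib)
    qed
    then show "AE x in lebesgue_on \<Omega>. norm ((norm (a *\<^sub>R u x + b *\<^sub>R v x))\<^sup>2)
        \<le> norm (2 * a\<^sup>2 * (norm (u x))\<^sup>2 + 2 * b\<^sup>2 * (norm (v x))\<^sup>2)"
      by (intro AE_I2) (simp add: abs_of_nonneg)
  qed measurable
qed measurable

lemma L2_space_diff:
  "u \<in> L2_space \<Omega> \<Longrightarrow> v \<in> L2_space \<Omega> \<Longrightarrow> (\<lambda>x. u x - v x) \<in> L2_space \<Omega>"
  using L2_space_lincomb[of u \<Omega> v 1 "-1"] by simp

lemma L2_inner_integrable:
  assumes [measurable]: "u \<in> L2_space \<Omega>" "v \<in> L2_space \<Omega>"
  shows "integrable (lebesgue_on \<Omega>) (\<lambda>x. u x \<bullet> v x)"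
proof (rule Bochner_Integration.integrable_bound)
  show "integrable (lebesgue_on \<Omega>) (\<lambda>x. (norm (u x))\<^sup>2 + (norm (v x))\<^sup>2)"
    using assms[THEN L2_space_integrable] by (rule Bochner_Integration.integrable_add)
  show "AE x in lebesgue_on \<Omega>. norm (u x \<bullet> v x) \<le> norm ((norm (u x))\<^sup>2 + (norm (v x))\<^sup>2)"
  proof (rule AE_I2)
    fix x
    have "\<bar>u x \<bullet> v x\<bar> \<le> norm (u x) * norm (v x)" by (rule Cauchy_Schwarz_ineq2)
    also have "\<dots> \<le> (norm (u x))\<^sup>2 + (norm (v x))\<^sup>2"
      using sum_squares_bound[of "norm (u x)" "norm (v x)"] mult_nonneg_nonneg[OF norm_ge_zero[of "u x"] norm_ge_zero[of "v x"]]
      unfolding mult.assoc by linarith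
    finally show "norm (u x \<bullet> v x) \<le> norm ((norm (u x))\<^sup>2 + (norm (v x))\<^sup>2)" by simp
  qed
qed measurable

lemma L2_norm_sq: "(L2_norm \<Omega> u)\<^sup>2 = L2_inner \<Omega> u u"
  by (simp add: L2_norm_def L2_inner_def integral_nonneg_AE)

lemma L2_norm_sq_integral: "(L2_norm \<Omega> u)\<^sup>2 = (LINT x|lebesgue_on \<Omega>. (norm (u x))\<^sup>2)"
  by (simp add: L2_norm_sq L2_inner_def power2_norm_eq_inner)

lemma L2_norm_nonneg [simp]: "0 \<le> L2_norm \<Omega> u"
  by (simp add: L2_norm_def L2_inner_def integral_nonneg_AE)

lemma L2_inner_commute: "L2_inner \<Omega> u v = L2_inner \<Omega> v u"
  by (simp add: L2_inner_def inner_commute)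

lemma L2_inner_lincomb_left:
  assumes "u \<in> L2_space \<Omega>" "v \<in> L2_space \<Omega>" "w \<in> L2_space \<Omega>"
  shows "L2_inner \<Omega> (\<lambda>x. a *\<^sub>R u x + b *\<^sub>R v x) w = a * L2_inner \<Omega> u w + b * L2_inner \<Omega> v w"
  using L2_inner_integrable[OF assms(1,3)] L2_inner_integrable[OF assms(2,3)]
  by (simp add: L2_inner_def inner_add_left)

lemma L2_inner_lincomb_right:
  assumes "u \<in> L2_space \<Omega>" "v \<in> L2_space \<Omega>" "w \<in> L2_space \<Omega>"
  shows "L2_inner \<Omega> w (\<lambda>x. a *\<^sub>R u x + b *\<^sub>R v x) = a * L2_inner \<Omega> w u + b * L2_inner \<Omega> w v"
  using L2_inner_lincomb_left[OF assms] by (simp add: L2_inner_commute)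

lemma L2_norm_lincomb_sq:
  assumes "u \<in> L2_space \<Omega>" "v \<in> L2_space \<Omega>"
  shows "(L2_norm \<Omega> (\<lambda>x. a *\<^sub>R u x + b *\<^sub>R v x))\<^sup>2 =
     a\<^sup>2 * (L2_norm \<Omega> u)\<^sup>2 + 2 * a * b * L2_inner \<Omega> u v + b\<^sup>2 * (L2_norm \<Omega> v)\<^sup>2"
  unfolding L2_norm_sq using assms L2_inner_commute[of \<Omega> v u]
  by (simp add: L2_inner_lincomb_left L2_inner_lincomb_right L2_space_lincomb
      power2_eq_square algebra_simps)

lemma L2_Cauchy_Schwarz:
  assumes "u \<in> L2_space \<Omega>" "v \<in> L2_space \<Omega>"
  shows "\<bar>L2_inner \<Omega> u v\<bar> \<le> L2_norm \<Omega> u * L2_norm \<Omega> v"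
proof -
  define a b c where "a = (L2_norm \<Omega> u)\<^sup>2" and "b = L2_inner \<Omega> u v" and "c = (L2_norm \<Omega> v)\<^sup>2"
  have quad: "0 \<le> s\<^sup>2 * a + 2 * s * t * b + t\<^sup>2 * c" for s t
    using L2_norm_lincomb_sq[OF assms, of s t] unfolding a_def b_def c_def by (metis zero_le_power2)
  have "b\<^sup>2 \<le> a * c"
  proof (cases "c = 0")
    case True
    \<comment> \<open>A quadratic form without \<open>t\<^sup>2\<close> term takes a negative value unless \<open>b = 0\<close>; this point gives \<open>- b\<^sup>2\<close>.\<close>
    have "0 \<le> b\<^sup>2 * a + 2 * b * (- (a + 1) / 2) * b + (- (a + 1) / 2)\<^sup>2 * c"
      by (rule quad)
    also have "\<dots> = - b\<^sup>2" using True by (simp add: power2_eq_square field_simps)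
    finally show ?thesis using True by simp
  next
    case False
    have "0 \<le> c\<^sup>2 * a + 2 * c * (- b) * b + (- b)\<^sup>2 * c" by (rule quad)
    also have "\<dots> = c * (a * c - b\<^sup>2)" by (simp add: power2_eq_square algebra_simps)
    finally have "0 \<le> c * (a * c - b\<^sup>2)" .
    moreover have "c > 0" using False by (simp add: c_def)
    ultimately show ?thesis by (simp add: zero_le_mult_iff)
  qed
  then have "\<bar>b\<bar>\<^sup>2 \<le> (L2_norm \<Omega> u * L2_norm \<Omega> v)\<^sup>2" by (simp add: a_def c_def power_mult_distrib)
  then show ?thesis unfolding b_def by (rule power2_le_imp_le) simp
qed

lemma L2_norm_lincomb_le:
  assumes "u \<in> L2_space \<Omega>" "v \<in> L2_space \<Omega>"
  shows "L2_norm \<Omega> (\<lambda>x. a *\<^sub>R u x + b *\<^sub>R v x) \<le> \<bar>a\<bar> * L2_norm \<Omega> u + \<bar>b\<bar> * L2_norm \<Omega> v"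
proof (rule power2_le_imp_le)
  have "a * b * L2_inner \<Omega> u v \<le> \<bar>a * b\<bar> * \<bar>L2_inner \<Omega> u v\<bar>"
    using abs_ge_self[of "a * b * L2_inner \<Omega> u v"] by (simp only: abs_mult)
  also have "\<dots> \<le> \<bar>a * b\<bar> * (L2_norm \<Omega> u * L2_norm \<Omega> v)"
    by (intro mult_left_mono L2_Cauchy_Schwarz assms) simp
  finally have "a * b * L2_inner \<Omega> u v \<le> \<bar>a * b\<bar> * (L2_norm \<Omega> u * L2_norm \<Omega> v)" .
  then show "(L2_norm \<Omega> (\<lambda>x. a *\<^sub>R u x + b *\<^sub>R v x))\<^sup>2 \<le> (\<bar>a\<bar> * L2_norm \<Omega> u + \<bar>b\<bar> * L2_norm \<Omega> v)\<^sup>2"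
    unfolding L2_norm_lincomb_sq[OF assms] by (simp add: power2_sum power_mult_distrib abs_mult mult.assoc mult.left_commute)
qed simp

lemma L2_norm_lincomb_tendsto_0:
  assumes "\<And>n. f n \<in> L2_space \<Omega>" "\<And>n. g n \<in> L2_space \<Omega>"
    and "(\<lambda>n. L2_norm \<Omega> (f n)) \<longlonglongrightarrow> 0" "(\<lambda>n. L2_norm \<Omega> (g n)) \<longlonglongrightarrow> 0"
  shows "(\<lambda>n. L2_norm \<Omega> (\<lambda>x. a *\<^sub>R f n x + b *\<^sub>R g n x)) \<longlonglongrightarrow> 0"
proof (rule tendsto_sandwich[of "\<lambda>_. 0" _ _ "\<lambda>n. \<bar>a\<bar> * L2_norm \<Omega> (f n) + \<bar>b\<bar> * L2_norm \<Omega> (g n)"])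
  show "\<forall>\<^sub>F n in sequentially. L2_norm \<Omega> (\<lambda>x. a *\<^sub>R f n x + b *\<^sub>R g n x) \<le> \<bar>a\<bar> * L2_norm \<Omega> (f n) + \<bar>b\<bar> * L2_norm \<Omega> (g n)"
    using assms by (intro always_eventually allI L2_norm_lincomb_le)
  show "(\<lambda>n. \<bar>a\<bar> * L2_norm \<Omega> (f n) + \<bar>b\<bar> * L2_norm \<Omega> (g n)) \<longlonglongrightarrow> 0"
    using tendsto_add[OF tendsto_mult_left[OF assms(3), of "\<bar>a\<bar>"] tendsto_mult_left[OF assms(4), of "\<bar>b\<bar>"]] by simp
  show "\<forall>\<^sub>F n in sequentially. 0 \<le> L2_norm \<Omega> (\<lambda>x. a *\<^sub>R f n x + b *\<^sub>R g n x)" by simp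
qed simp

lemma L2_norm_eq_0_imp_AE:
  assumes [measurable]: "u \<in> L2_space \<Omega>" and "L2_norm \<Omega> u = 0"
  shows "AE x in lebesgue_on \<Omega>. u x = 0"
proof -
  have "(LINT x|lebesgue_on \<Omega>. (norm (u x))\<^sup>2) = 0"
    using assms(2) L2_norm_sq[of \<Omega> u] by (simp add: L2_inner_def power2_norm_eq_inner)
  then have "AE x in lebesgue_on \<Omega>. (norm (u x))\<^sup>2 = 0"
    using integral_nonneg_eq_0_iff_AE[OF L2_space_integrable[OF assms(1)]] by simp
  then show ?thesis by simp
qed

lemma L2_inner_cong_AE:
  assumes [measurable]: "u \<in> L2_space \<Omega>" "u' \<in> L2_space \<Omega>" "v \<in> L2_space \<Omega>" "v' \<in> L2_space \<Omega>"
    and "AE x in lebesgue_on \<Omega>. u x = u' x" "AE x in lebesgue_on \<Omega>. v x = v' x"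
  shows "L2_inner \<Omega> u v = L2_inner \<Omega> u' v'"
  unfolding L2_inner_def
proof (rule integral_cong_AE)
  show "AE x in lebesgue_on \<Omega>. u x \<bullet> v x = u' x \<bullet> v' x" using assms(5,6) by eventually_elim simp
qed measurable

lemma L2_norm_minus_commute: "L2_norm \<Omega> (\<lambda>x. u x - v x) = L2_norm \<Omega> (\<lambda>x. v x - u x)"
proof -
  have "(u x - v x) \<bullet> (u x - v x) = (v x - u x) \<bullet> (v x - u x)" for x
    by (simp add: inner_diff_left inner_diff_right inner_commute)
  then show ?thesis unfolding L2_norm_def L2_inner_def by simp
qed

text \<open>The form of the triangle inequality that bounds the norms of an approximating sequence.\<close>

lemma L2_norm_le_diff_add:
  assumes "u \<in> L2_space \<Omega>" "v \<in> L2_space \<Omega>"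
  shows "L2_norm \<Omega> u \<le> L2_norm \<Omega> (\<lambda>x. u x - v x) + L2_norm \<Omega> v"
  using L2_norm_lincomb_le[OF L2_space_diff[OF assms] assms(2), of 1 1] by simp

lemma L2_space_component:
  fixes G :: "'a::euclidean_space \<Rightarrow> real^'d"
  assumes [measurable]: "G \<in> L2_space \<Omega>"
  shows "(\<lambda>x. G x $ j) \<in> L2_space \<Omega>"
proof (rule L2_spaceI)
  show m: "(\<lambda>x. G x $ j) \<in> borel_measurable (lebesgue_on \<Omega>)"
    by (rule measurable_compose[OF L2_space_measurable[OF assms]])
       (intro borel_measurable_continuous_onI continuous_intros)
  have "(norm (G x $ j))\<^sup>2 \<le> (norm (G x))\<^sup>2" for x
    by (intro power_mono) (auto simp: component_le_norm_cart)
  then show "integrable (lebesgue_on \<Omega>) (\<lambda>x. (norm (G x $ j))\<^sup>2)"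
    using m by (intro Bochner_Integration.integrable_bound[OF L2_space_integrable[OF assms]]) auto
qed

lemma L2_norm_component_le:
  fixes G :: "'a::euclidean_space \<Rightarrow> real^'d"
  assumes "G \<in> L2_space \<Omega>"
  shows "L2_norm \<Omega> (\<lambda>x. G x $ j) \<le> L2_norm \<Omega> G"
proof -
  have "L2_inner \<Omega> (\<lambda>x. G x $ j) (\<lambda>x. G x $ j) \<le> L2_inner \<Omega> G G"
    unfolding L2_inner_def
  proof (rule integral_mono)
    show "G x $ j \<bullet> G x $ j \<le> G x \<bullet> G x" for x
      using power_mono[OF component_le_norm_cart[of "G x" j], of 2] by (simp add: power2_norm_eq_inner) (simp add: power2_eq_square)
  qed (intro L2_inner_integrable L2_space_component assms)+
  then show ?thesis by (simp add: L2_norm_def)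
qed

lemma L2_space_vecI:
  fixes G :: "'a::euclidean_space \<Rightarrow> 'b::euclidean_space^'d"
  assumes "\<And>j. (\<lambda>x. G x $ j) \<in> L2_space \<Omega>"
  shows "G \<in> L2_space \<Omega>"
proof (rule L2_spaceI)
  note [measurable] = assms[THEN L2_space_measurable]
  show "G \<in> borel_measurable (lebesgue_on \<Omega>)"
  proof (rule borel_measurable_euclidean_space[THEN iffD2], rule ballI)
    fix b :: "'b^'d" assume "b \<in> Basis"
    then obtain i u where "b = axis i u" by (auto simp: Basis_vec_def)
    then show "(\<lambda>x. G x \<bullet> b) \<in> borel_measurable (lebesgue_on \<Omega>)" by (simp add: inner_axis)
  qed
  have "(norm (G x))\<^sup>2 = (\<Sum>j\<in>UNIV. (norm (G x $ j))\<^sup>2)" for x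
    by (simp add: power2_norm_eq_inner inner_vec_def)
  then show "integrable (lebesgue_on \<Omega>) (\<lambda>x. (norm (G x))\<^sup>2)"
    using assms by (simp add: L2_space_integrable)
qed

section \<open>Functions in \<open>H\<^sup>1\<^sub>0\<close> and their gradients\<close>

lemma restrict_lebesgue_integrals:
  fixes g :: "real^'d \<Rightarrow> real"
  assumes "open \<Omega>" and [measurable]: "g \<in> borel_measurable borel" and zero: "\<And>x. x \<notin> \<Omega> \<Longrightarrow> g x = 0"
  shows "(LINT x|lebesgue_on \<Omega>. g x) = (LINT x|lborel. g x)"
    and "integrable (lebesgue_on \<Omega>) g \<longleftrightarrow> integrable lborel g"
    and "(\<integral>\<^sup>+x. ennreal (g x) \<partial>lebesgue_on \<Omega>) = (\<integral>\<^sup>+x. ennreal (g x) \<partial>lborel)"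
proof -
  have \<Omega>: "\<Omega> \<inter> space lebesgue \<in> sets lebesgue" using assms(1) by (simp add: borel_open)
  have g: "indicator \<Omega> x *\<^sub>R g x = g x" for x using zero by (auto simp: indicator_def)
  have g2: "ennreal (g x) * indicator \<Omega> x = ennreal (g x)" for x using zero by (auto simp: indicator_def)
  show "(LINT x|lebesgue_on \<Omega>. g x) = (LINT x|lborel. g x)"
    using integral_restrict_space[OF \<Omega>, of g] by (simp add: g integral_completion del: real_scaleR_def)
  show "integrable (lebesgue_on \<Omega>) g \<longleftrightarrow> integrable lborel g"
    using integrable_restrict_space[OF \<Omega>, of g] by (simp add: g integrable_completion del: real_scaleR_def)
  show "(\<integral>\<^sup>+x. ennreal (g x) \<partial>lebesgue_on \<Omega>) = (\<integral>\<^sup>+x. ennreal (g x) \<partial>lborel)"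
    using nn_integral_restrict_space[OF \<Omega>, of "\<lambda>x. ennreal (g x)"] by (simp add: g2 nn_integral_completion)
qed

lemma test_function_measurable: "\<phi> \<in> test_functions \<Omega> \<Longrightarrow> \<phi> \<in> borel_measurable borel"
  by (intro borel_measurable_continuous_onI test_function_continuous)

lemma test_function_integral:
  assumes "open \<Omega>" "\<phi> \<in> test_functions \<Omega>"
  shows "integrable (lebesgue_on \<Omega>) \<phi>" "(LINT x|lebesgue_on \<Omega>. \<phi> x) = (LINT x|lborel. \<phi> x)"
  using restrict_lebesgue_integrals[OF assms(1) test_function_measurable[OF assms(2)] test_function_zero_outside[OF assms(2)]]
    test_function_integrable[OF assms(2)] by auto

lemma test_function_L2:
  assumes "open \<Omega>" "\<phi> \<in> test_functions \<Omega>"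
  shows "\<phi> \<in> L2_space \<Omega>"
proof (rule L2_spaceI)
  show "\<phi> \<in> borel_measurable (lebesgue_on \<Omega>)"
    by (rule borel_measurable_integrable[OF test_function_integral(1)[OF assms]])
  show "integrable (lebesgue_on \<Omega>) (\<lambda>x. (norm (\<phi> x))\<^sup>2)"
    using test_function_integral(1)[OF assms(1) test_function_mult[OF assms(2,2)]] by (simp add: power2_eq_square)
qed

lemma test_function_grad_L2:
  assumes "open \<Omega>" "\<phi> \<in> test_functions \<Omega>"
  shows "(\<lambda>x. \<chi> j. partial j \<phi> x) \<in> L2_space \<Omega>"
  by (rule L2_space_vecI) (simp add: test_function_L2[OF assms(1) test_function_partial[OF assms(2)]])

text \<open>The product of two test functions is a test function, whose derivatives have integral zero.\<close>

lemma test_function_parts: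
  assumes "open \<Omega>" "\<phi> \<in> test_functions \<Omega>" "\<psi> \<in> test_functions \<Omega>"
  shows "(LINT x|lebesgue_on \<Omega>. \<phi> x * partial j \<psi> x) = - (LINT x|lebesgue_on \<Omega>. partial j \<phi> x * \<psi> x)"
proof -
  let ?p = "\<lambda>x. \<phi> x * partial j \<psi> x" and ?q = "\<lambda>x. partial j \<phi> x * \<psi> x"
  have t: "?p \<in> test_functions \<Omega>" "?q \<in> test_functions \<Omega>"
    by (intro test_function_mult test_function_partial assms)+
  have pq: "partial j (\<lambda>x. \<phi> x * \<psi> x) = (\<lambda>x. ?p x + ?q x)"
    using partial_mult[OF test_function_differentiable[OF assms(2)] test_function_differentiable[OF assms(3)]] by blast
  have "(LINT x|lborel. ?p x + ?q x) = 0"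
    using integral_partial_test_function[OF test_function_mult[OF assms(2,3)], of j] unfolding pq .
  then have "(LINT x|lborel. ?p x) + (LINT x|lborel. ?q x) = 0"
    using t[THEN test_function_integrable] by simp
  then show ?thesis
    using t[THEN test_function_integral(2)[OF assms(1)]] by simp
qed

lemma L2_norm_zero [simp]: "L2_norm \<Omega> (\<lambda>x. 0) = 0"
  by (simp add: L2_norm_def L2_inner_def)

lemma H10_gradient_test_function:
  assumes "open \<Omega>" "\<phi> \<in> test_functions \<Omega>"
  shows "H10_gradient \<Omega> \<phi> (\<lambda>x. \<chi> j. partial j \<phi> x)"
  unfolding H10_gradient_def has_weak_gradient_def
  using assms test_function_L2[OF assms] test_function_grad_L2[OF assms] test_function_parts[OF assms]
  by (auto intro!: exI[of _ "\<lambda>_. \<phi>"])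

lemma H10_gradientD:
  assumes "H10_gradient \<Omega> u G"
  shows "u \<in> L2_space \<Omega>" "G \<in> L2_space \<Omega>" "has_weak_gradient \<Omega> u G"
    "\<exists>\<phi>. (\<forall>n::nat. \<phi> n \<in> test_functions \<Omega>) \<and>
          (\<lambda>n. L2_norm \<Omega> (\<lambda>x. \<phi> n x - u x)) \<longlonglongrightarrow> 0 \<and>
          (\<lambda>n. L2_norm \<Omega> (\<lambda>x. (\<chi> j. partial j (\<phi> n) x) - G x)) \<longlonglongrightarrow> 0"
  using assms unfolding H10_gradient_def by blast+

lemma H10_gradient_lincomb:
  fixes u w :: "real^'d \<Rightarrow> real"
  assumes \<Omega>: "open \<Omega>" and u: "H10_gradient \<Omega> u G" and w: "H10_gradient \<Omega> w H"
  shows "H10_gradient \<Omega> (\<lambda>x. a * u x + b * w x) (\<lambda>x. a *\<^sub>R G x + b *\<^sub>R H x)"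
  unfolding H10_gradient_def
proof (intro conjI)
  show "(\<lambda>x. a * u x + b * w x) \<in> L2_space \<Omega>"
    using L2_space_lincomb[OF H10_gradientD(1)[OF u] H10_gradientD(1)[OF w], of a b] by simp
  show "(\<lambda>x. a *\<^sub>R G x + b *\<^sub>R H x) \<in> L2_space \<Omega>"
    by (rule L2_space_lincomb[OF H10_gradientD(2)[OF u] H10_gradientD(2)[OF w]])
  show "has_weak_gradient \<Omega> (\<lambda>x. a * u x + b * w x) (\<lambda>x. a *\<^sub>R G x + b *\<^sub>R H x)"
    unfolding has_weak_gradient_def
  proof (intro ballI allI)
    fix \<phi> j assume \<phi>: "\<phi> \<in> test_functions \<Omega>"
    note L = test_function_L2[OF \<Omega> \<phi>] test_function_L2[OF \<Omega> test_function_partial[OF \<phi>, of j]]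
    have i: "integrable (lebesgue_on \<Omega>) (\<lambda>x. u x * partial j \<phi> x)" "integrable (lebesgue_on \<Omega>) (\<lambda>x. w x * partial j \<phi> x)"
        "integrable (lebesgue_on \<Omega>) (\<lambda>x. G x $ j * \<phi> x)" "integrable (lebesgue_on \<Omega>) (\<lambda>x. H x $ j * \<phi> x)"
      using L2_inner_integrable[OF H10_gradientD(1)[OF u] L(2)] L2_inner_integrable[OF H10_gradientD(1)[OF w] L(2)]
       L2_inner_integrable[OF L2_space_component[OF H10_gradientD(2)[OF u]] L(1)]
       L2_inner_integrable[OF L2_space_component[OF H10_gradientD(2)[OF w]] L(1)] by simp_all
    have e: "(LINT x|lebesgue_on \<Omega>. u x * partial j \<phi> x) = - (LINT x|lebesgue_on \<Omega>. G x $ j * \<phi> x)"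
       "(LINT x|lebesgue_on \<Omega>. w x * partial j \<phi> x) = - (LINT x|lebesgue_on \<Omega>. H x $ j * \<phi> x)"
      using H10_gradientD(3)[OF u] H10_gradientD(3)[OF w] \<phi> unfolding has_weak_gradient_def by blast+
    show "(LINT x|lebesgue_on \<Omega>. (a * u x + b * w x) * partial j \<phi> x) =
        - (LINT x|lebesgue_on \<Omega>. (a *\<^sub>R G x + b *\<^sub>R H x) $ j * \<phi> x)"
      using i e by (simp add: distrib_right mult.assoc)
  qed
  obtain \<phi> where \<phi>: "\<forall>n::nat. \<phi> n \<in> test_functions \<Omega>" "(\<lambda>n. L2_norm \<Omega> (\<lambda>x. \<phi> n x - u x)) \<longlonglongrightarrow> 0"
      "(\<lambda>n. L2_norm \<Omega> (\<lambda>x. (\<chi> j. partial j (\<phi> n) x) - G x)) \<longlonglongrightarrow> 0"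
    using H10_gradientD(4)[OF u] by blast
  obtain \<psi> where \<psi>: "\<forall>n::nat. \<psi> n \<in> test_functions \<Omega>" "(\<lambda>n. L2_norm \<Omega> (\<lambda>x. \<psi> n x - w x)) \<longlonglongrightarrow> 0"
      "(\<lambda>n. L2_norm \<Omega> (\<lambda>x. (\<chi> j. partial j (\<psi> n) x) - H x)) \<longlonglongrightarrow> 0"
    using H10_gradientD(4)[OF w] by blast
  have t: "\<phi> n \<in> test_functions \<Omega>" "\<psi> n \<in> test_functions \<Omega>" for n using \<phi>(1) \<psi>(1) by auto
  show "\<exists>\<theta>. (\<forall>n::nat. \<theta> n \<in> test_functions \<Omega>) \<and>
     (\<lambda>n. L2_norm \<Omega> (\<lambda>x. \<theta> n x - (a * u x + b * w x))) \<longlonglongrightarrow> 0 \<and>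
     (\<lambda>n. L2_norm \<Omega> (\<lambda>x. (\<chi> j. partial j (\<theta> n) x) - (a *\<^sub>R G x + b *\<^sub>R H x))) \<longlonglongrightarrow> 0"
  proof (intro exI conjI allI)
    show "(\<lambda>x. a * \<phi> n x + b * \<psi> n x) \<in> test_functions \<Omega>" for n by (intro test_function_lincomb t)
    have "(\<lambda>n. L2_norm \<Omega> (\<lambda>x. a *\<^sub>R (\<phi> n x - u x) + b *\<^sub>R (\<psi> n x - w x))) \<longlonglongrightarrow> 0"
      by (intro L2_norm_lincomb_tendsto_0 L2_space_diff test_function_L2 \<Omega> t \<phi> \<psi> H10_gradientD(1)[OF u] H10_gradientD(1)[OF w])
    then show "(\<lambda>n. L2_norm \<Omega> (\<lambda>x. a * \<phi> n x + b * \<psi> n x - (a * u x + b * w x))) \<longlonglongrightarrow> 0"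
      by (simp add: algebra_simps)
    have "(\<lambda>n. L2_norm \<Omega> (\<lambda>x. a *\<^sub>R ((\<chi> j. partial j (\<phi> n) x) - G x) + b *\<^sub>R ((\<chi> j. partial j (\<psi> n) x) - H x))) \<longlonglongrightarrow> 0"
      by (intro L2_norm_lincomb_tendsto_0 L2_space_diff test_function_grad_L2 \<Omega> t \<phi> \<psi> H10_gradientD(2)[OF u] H10_gradientD(2)[OF w])
    moreover have "(\<chi> j. partial j (\<lambda>x. a * \<phi> n x + b * \<psi> n x) x) - (a *\<^sub>R G x + b *\<^sub>R H x) =
        a *\<^sub>R ((\<chi> j. partial j (\<phi> n) x) - G x) + b *\<^sub>R ((\<chi> j. partial j (\<psi> n) x) - H x)" for n x
      by (simp add: vec_eq_iff algebra_simps partial_lincomb[OF test_function_differentiable[OF t(1)] test_function_differentiable[OF t(2)]])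
    ultimately show "(\<lambda>n. L2_norm \<Omega> (\<lambda>x. (\<chi> j. partial j (\<lambda>x. a * \<phi> n x + b * \<psi> n x) x) - (a *\<^sub>R G x + b *\<^sub>R H x))) \<longlonglongrightarrow> 0"
      by simp
  qed
qed

text \<open>\<open>G\<close> is orthogonal to all test functions, because it is a weak gradient of the null function,
  and it is an \<open>L\<^sup>2\<close> limit of test functions, namely of the derivatives of the approximants.\<close>

lemma H10_gradient_of_null:
  assumes \<Omega>: "open \<Omega>" and u: "H10_gradient \<Omega> u G" and 0: "AE x in lebesgue_on \<Omega>. u x = 0"
  shows "AE x in lebesgue_on \<Omega>. G x = 0"
proof -
  note [measurable] = H10_gradientD(1)[OF u] H10_gradientD(2)[OF u]
  obtain \<phi> where \<phi>: "\<forall>n::nat. \<phi> n \<in> test_functions \<Omega>"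
      "(\<lambda>n. L2_norm \<Omega> (\<lambda>x. (\<chi> j. partial j (\<phi> n) x) - G x)) \<longlonglongrightarrow> 0"
    using H10_gradientD(4)[OF u] by blast
  have "AE x in lebesgue_on \<Omega>. G x $ j = 0" for j
  proof (rule L2_norm_eq_0_imp_AE)
    let ?g = "\<lambda>x. G x $ j"
    show g: "?g \<in> L2_space \<Omega>" by (rule L2_space_component[OF H10_gradientD(2)[OF u]])
    have "L2_norm \<Omega> ?g \<le> L2_norm \<Omega> (\<lambda>x. (\<chi> j. partial j (\<phi> n) x) - G x)" (is "_ \<le> ?e n") for n
    proof -
      let ?p = "partial j (\<phi> n)"
      have t: "?p \<in> test_functions \<Omega>" using \<phi>(1) test_function_partial by blast
      note [measurable] = L2_space_measurable[OF test_function_L2[OF \<Omega> test_function_partial[OF t, of j]]]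
      have "(LINT x|lebesgue_on \<Omega>. u x * partial j ?p x) = (LINT x|lebesgue_on \<Omega>. 0)"
        using 0 by (intro integral_cong_AE) (measurable, auto)
      then have orth: "L2_inner \<Omega> ?g ?p = 0"
        using H10_gradientD(3)[OF u] t unfolding has_weak_gradient_def L2_inner_def by auto
      have "(L2_norm \<Omega> ?g)\<^sup>2 = L2_inner \<Omega> ?g (\<lambda>x. 1 *\<^sub>R ?g x + (-1) *\<^sub>R ?p x)"
        unfolding L2_inner_lincomb_right[OF g test_function_L2[OF \<Omega> t] g] by (simp add: orth L2_norm_sq)
      also have "\<dots> = L2_inner \<Omega> ?g (\<lambda>x. ?g x - ?p x)" by simp
      also have "\<dots> \<le> L2_norm \<Omega> ?g * L2_norm \<Omega> (\<lambda>x. ?g x - ?p x)"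
        using L2_Cauchy_Schwarz[OF g L2_space_diff[OF g test_function_L2[OF \<Omega> t]]] by simp
      also have "L2_norm \<Omega> (\<lambda>x. ?g x - ?p x) \<le> ?e n"
        using L2_norm_component_le[OF L2_space_diff[OF test_function_grad_L2[OF \<Omega>] H10_gradientD(2)[OF u]], of "\<phi> n" j] \<phi>(1)
          L2_norm_minus_commute[of \<Omega> ?g ?p] by simp
      finally have "L2_norm \<Omega> ?g * L2_norm \<Omega> ?g \<le> L2_norm \<Omega> ?g * ?e n"
        by (simp add: power2_eq_square mult_left_mono)
      then show ?thesis
        by (cases "L2_norm \<Omega> ?g = 0") (auto simp: mult_le_cancel_left order.strict_iff_order)
    qed
    then have "L2_norm \<Omega> ?g \<le> 0"
      using \<phi>(2) by (intro LIMSEQ_le_const) auto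
    then show "L2_norm \<Omega> ?g = 0" using L2_norm_nonneg[of \<Omega> ?g] by linarith
  qed
  then have "AE x in lebesgue_on \<Omega>. \<forall>j\<in>UNIV. G x $ j = 0" by (intro AE_finite_allI) auto
  then show ?thesis by eventually_elim (simp add: vec_eq_iff)
qed

lemma H10_gradient_unique:
  assumes \<Omega>: "open \<Omega>" and "H10_gradient \<Omega> u G" "H10_gradient \<Omega> w H" and "AE x in lebesgue_on \<Omega>. u x = w x"
  shows "AE x in lebesgue_on \<Omega>. G x = H x"
proof -
  have "AE x in lebesgue_on \<Omega>. 1 *\<^sub>R G x + (-1) *\<^sub>R H x = 0"
  proof (rule H10_gradient_of_null[OF \<Omega> H10_gradient_lincomb[OF assms(1-3)]])
    show "AE x in lebesgue_on \<Omega>. 1 * u x + (-1) * w x = 0" using assms(4) by eventually_elim simp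
  qed
  then show ?thesis by eventually_elim simp
qed

text \<open>The fourth powers of the approximating test functions have bounded integrals by
  Ladyzhenskaya's inequality, and Fatou's lemma passes the bound to the limit.\<close>

lemma H10_fourth_power_integrable:
  fixes u :: "real^'d \<Rightarrow> real"
  assumes \<Omega>: "open \<Omega>" and d: "CARD('d) = 2 \<or> CARD('d) = 3" and u: "H10_gradient \<Omega> u G"
  shows "integrable (lebesgue_on \<Omega>) (\<lambda>x. u x ^ 4)"
proof -
  let ?M = "lebesgue_on \<Omega>"
  note uL = H10_gradientD(1)[OF u] and GL = H10_gradientD(2)[OF u]
  note [measurable] = L2_space_measurable[OF uL]
  obtain \<phi> where \<phi>: "\<forall>n::nat. \<phi> n \<in> test_functions \<Omega>" "(\<lambda>n. L2_norm \<Omega> (\<lambda>x. \<phi> n x - u x)) \<longlonglongrightarrow> 0"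
      "(\<lambda>n. L2_norm \<Omega> (\<lambda>x. (\<chi> j. partial j (\<phi> n) x) - G x)) \<longlonglongrightarrow> 0"
    using H10_gradientD(4)[OF u] by blast
  have t: "\<phi> n \<in> test_functions \<Omega>" for n using \<phi>(1) by auto
  note tL = test_function_L2[OF \<Omega> t] and tG = test_function_grad_L2[OF \<Omega> t]
  note [measurable] = L2_space_measurable[OF tL]
  obtain A where A: "\<And>n. L2_norm \<Omega> (\<lambda>x. \<phi> n x - u x) \<le> A"
    using convergent_imp_Bseq[OF convergentI[OF \<phi>(2)]] by (auto simp: Bseq_def)
  obtain B where B: "\<And>n. L2_norm \<Omega> (\<lambda>x. (\<chi> j. partial j (\<phi> n) x) - G x) \<le> B"
    using convergent_imp_Bseq[OF convergentI[OF \<phi>(3)]] by (auto simp: Bseq_def)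
  define C where "C = (A + L2_norm \<Omega> u)\<^sup>2 + (B + L2_norm \<Omega> G)\<^sup>2"
  have bound: "(\<integral>\<^sup>+x. ennreal (\<phi> n x ^ 4) \<partial>?M) \<le> 4 * (ennreal C)\<^sup>2" for n
  proof -
    let ?h = "\<lambda>x. (\<phi> n x)\<^sup>2 + (norm (\<chi> j. partial j (\<phi> n) x))\<^sup>2"
    have "L2_norm \<Omega> (\<phi> n) \<le> A + L2_norm \<Omega> u"
      using L2_norm_le_diff_add[OF tL uL, of n] A[of n] by simp
    moreover have "L2_norm \<Omega> (\<lambda>x. \<chi> j. partial j (\<phi> n) x) \<le> B + L2_norm \<Omega> G"
      using L2_norm_le_diff_add[OF tG GL, of n] B[of n] by simp
    ultimately have C: "(L2_norm \<Omega> (\<phi> n))\<^sup>2 + (L2_norm \<Omega> (\<lambda>x. \<chi> j. partial j (\<phi> n) x))\<^sup>2 \<le> C"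
      unfolding C_def by (intro add_mono power_mono) auto
    have "integrable ?M ?h"
      using L2_space_integrable[OF tL[of n]] L2_space_integrable[OF tG[of n]] by simp
    then have "(\<integral>\<^sup>+x. ennreal (?h x) \<partial>?M) = ennreal (LINT x|?M. ?h x)"
      by (rule nn_integral_eq_integral) simp
    also have "(LINT x|?M. ?h x) = (L2_norm \<Omega> (\<phi> n))\<^sup>2 + (L2_norm \<Omega> (\<lambda>x. \<chi> j. partial j (\<phi> n) x))\<^sup>2"
      using L2_space_integrable[OF tL[of n]] L2_space_integrable[OF tG[of n]]
      by (simp add: L2_norm_sq_integral)
    finally have h: "(\<integral>\<^sup>+x. ennreal (?h x) \<partial>?M) \<le> ennreal C"
      using ennreal_leI[OF C] by (rule ord_eq_le_trans)
    have z: "\<phi> n x = 0" "partial j (\<phi> n) x = 0" if "x \<notin> \<Omega>" for x j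
      using that test_function_zero_outside[OF t] test_function_zero_outside[OF test_function_partial[OF t]] by auto
    note m = test_function_measurable[OF t[of n], measurable] test_function_grad_measurable[OF t[of n], measurable]
    have "(\<integral>\<^sup>+x. ennreal (\<phi> n x ^ 4) \<partial>?M) = (\<integral>\<^sup>+x. ennreal (\<phi> n x ^ 4) \<partial>lborel)"
      by (rule restrict_lebesgue_integrals(3)[OF \<Omega>]) (use z m in auto)
    also have "\<dots> \<le> 4 * (\<integral>\<^sup>+x. ennreal (?h x) \<partial>lborel)\<^sup>2" by (rule Ladyzhenskaya[OF t d])
    also have "(\<integral>\<^sup>+x. ennreal (?h x) \<partial>lborel) = (\<integral>\<^sup>+x. ennreal (?h x) \<partial>?M)"
    proof (rule restrict_lebesgue_integrals(3)[OF \<Omega>, symmetric])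
      show "?h \<in> borel_measurable borel" by measurable
      show "?h x = 0" if "x \<notin> \<Omega>" for x
      proof -
        have "(\<chi> j. partial j (\<phi> n) x) = 0" using z(2)[OF that] by (simp add: vec_eq_iff)
        then show ?thesis using z(1)[OF that] by simp
      qed
    qed
    also have "4 * (\<integral>\<^sup>+x. ennreal (?h x) \<partial>?M)\<^sup>2 \<le> 4 * (ennreal C)\<^sup>2"
      by (intro mult_left_mono power_mono h) auto
    finally show ?thesis .
  qed
  have "(\<lambda>n. (L2_norm \<Omega> (\<lambda>x. \<phi> n x - u x))\<^sup>2) \<longlonglongrightarrow> 0\<^sup>2" by (intro tendsto_power \<phi>)
  then have "(\<lambda>n. LINT x|?M. norm ((norm (\<phi> n x - u x))\<^sup>2)) \<longlonglongrightarrow> 0"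
    by (simp add: L2_norm_sq_integral)
  then obtain r where r: "strict_mono r" "AE x in ?M. (\<lambda>n. (norm (\<phi> (r n) x - u x))\<^sup>2) \<longlonglongrightarrow> 0"
    using tendsto_L1_AE_subseq[of ?M "\<lambda>n x. (norm (\<phi> n x - u x))\<^sup>2"] L2_space_integrable[OF L2_space_diff[OF tL uL]] by blast
  have "AE x in ?M. ennreal (u x ^ 4) = liminf (\<lambda>n. ennreal (\<phi> (r n) x ^ 4))"
    using r(2)
  proof eventually_elim
    fix x assume "(\<lambda>n. (norm (\<phi> (r n) x - u x))\<^sup>2) \<longlonglongrightarrow> 0"
    then have "(\<lambda>n. sqrt ((norm (\<phi> (r n) x - u x))\<^sup>2)) \<longlonglongrightarrow> sqrt 0" by (rule tendsto_real_sqrt)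
    then have "(\<lambda>n. \<phi> (r n) x) \<longlonglongrightarrow> u x"
      by (simp add: LIM_zero_iff tendsto_norm_zero_iff tendsto_rabs_zero_iff)
    then have "(\<lambda>n. ennreal (\<phi> (r n) x ^ 4)) \<longlonglongrightarrow> ennreal (u x ^ 4)"
      by (intro tendsto_ennrealI tendsto_power)
    then show "ennreal (u x ^ 4) = liminf (\<lambda>n. ennreal (\<phi> (r n) x ^ 4))"
      by (intro lim_imp_Liminf[symmetric]) auto
  qed
  then have "(\<integral>\<^sup>+x. ennreal (u x ^ 4) \<partial>?M) = (\<integral>\<^sup>+x. liminf (\<lambda>n. ennreal (\<phi> (r n) x ^ 4)) \<partial>?M)"
    by (rule nn_integral_cong_AE)
  also have "\<dots> \<le> liminf (\<lambda>n. \<integral>\<^sup>+x. ennreal (\<phi> (r n) x ^ 4) \<partial>?M)"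
    by (rule nn_integral_liminf) measurable
  also have "\<dots> \<le> 4 * (ennreal C)\<^sup>2"
    by (intro Liminf_le always_eventually allI bound) simp
  also have "\<dots> < \<infinity>" by (simp add: ennreal_mult_less_top power_less_top_ennreal)
  finally have "(\<integral>\<^sup>+x. ennreal (u x ^ 4) \<partial>?M) < \<infinity>" .
  then show ?thesis by (intro integrableI_nonneg) auto
qed

lemma const_L2:
  fixes \<Omega> :: "'a::euclidean_space set"
  assumes \<Omega>: "open \<Omega>" "bounded \<Omega>"
  shows "(\<lambda>x. c::real) \<in> L2_space \<Omega>"
proof (rule L2_spaceI)
  have "emeasure lebesgue \<Omega> < \<infinity>"
    using emeasure_bounded_finite[OF \<Omega>(2)] \<Omega>(1) by (simp add: borel_open)
  then have "finite_measure (lebesgue_on \<Omega>)"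
    using \<Omega>(1) by (intro finite_measureI) (simp add: emeasure_restrict_space borel_open space_restrict_space)
  then show "integrable (lebesgue_on \<Omega>) (\<lambda>x. (norm c)\<^sup>2)"
    using finite_measure.integrable_const by fastforce
qed simp

text \<open>The approximating gradients have integral zero, and on a bounded domain \<open>L\<^sup>2\<close> convergence implies
  convergence of the integrals.\<close>

lemma H10_gradient_integral_zero:
  fixes u :: "real^'d \<Rightarrow> real"
  assumes \<Omega>: "open \<Omega>" "bounded \<Omega>" and u: "H10_gradient \<Omega> u G"
  shows "(LINT x|lebesgue_on \<Omega>. G x $ j) = 0"
proof -
  obtain \<phi> where \<phi>: "\<forall>n::nat. \<phi> n \<in> test_functions \<Omega>"
      "(\<lambda>n. L2_norm \<Omega> (\<lambda>x. (\<chi> j. partial j (\<phi> n) x) - G x)) \<longlonglongrightarrow> 0"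
    using H10_gradientD(4)[OF u] by blast
  have t: "\<phi> n \<in> test_functions \<Omega>" for n using \<phi>(1) by auto
  note GL = H10_gradientD(2)[OF u] and tG = test_function_grad_L2[OF \<Omega>(1) t]
  note one = const_L2[OF \<Omega>, of 1]
  have "\<bar>LINT x|lebesgue_on \<Omega>. G x $ j\<bar> \<le> L2_norm \<Omega> (\<lambda>x. (\<chi> j. partial j (\<phi> n) x) - G x) * L2_norm \<Omega> (\<lambda>x. 1::real)" for n
  proof -
    let ?e = "\<lambda>x. (\<chi> j. partial j (\<phi> n) x) - G x"
    have e: "?e \<in> L2_space \<Omega>" by (rule L2_space_diff[OF tG GL])
    have p: "partial j (\<phi> n) \<in> test_functions \<Omega>" by (rule test_function_partial[OF t])
    have "L2_inner \<Omega> (\<lambda>x. ?e x $ j) (\<lambda>x. 1::real) = L2_inner \<Omega> (\<lambda>x. 1 *\<^sub>R partial j (\<phi> n) x + (-1) *\<^sub>R G x $ j) (\<lambda>x. 1::real)"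
      by simp
    also have "\<dots> = L2_inner \<Omega> (partial j (\<phi> n)) (\<lambda>x. 1) - L2_inner \<Omega> (\<lambda>x. G x $ j) (\<lambda>x. 1)"
      by (subst L2_inner_lincomb_left[OF test_function_L2[OF \<Omega>(1) p] L2_space_component[OF GL] one]) simp
    also have "L2_inner \<Omega> (partial j (\<phi> n)) (\<lambda>x. 1) = 0"
      using test_function_integral(2)[OF \<Omega>(1) p] integral_partial_test_function[OF t] by (simp add: L2_inner_def)
    finally have "\<bar>LINT x|lebesgue_on \<Omega>. G x $ j\<bar> = \<bar>L2_inner \<Omega> (\<lambda>x. ?e x $ j) (\<lambda>x. 1::real)\<bar>"
      by (simp add: L2_inner_def)
    also have "\<dots> \<le> L2_norm \<Omega> (\<lambda>x. ?e x $ j) * L2_norm \<Omega> (\<lambda>x. 1::real)"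
      by (rule L2_Cauchy_Schwarz[OF L2_space_component[OF e] one])
    also have "\<dots> \<le> L2_norm \<Omega> ?e * L2_norm \<Omega> (\<lambda>x. 1::real)"
      by (intro mult_right_mono L2_norm_component_le e) simp
    finally show ?thesis .
  qed
  moreover have "(\<lambda>n. L2_norm \<Omega> (\<lambda>x. (\<chi> j. partial j (\<phi> n) x) - G x) * L2_norm \<Omega> (\<lambda>x. 1::real)) \<longlonglongrightarrow> 0"
    using tendsto_mult_right[OF \<phi>(2), of "L2_norm \<Omega> (\<lambda>x. 1::real)"] by simp
  ultimately have "\<bar>LINT x|lebesgue_on \<Omega>. G x $ j\<bar> \<le> 0"
    by (intro LIMSEQ_le_const) auto
  then show ?thesis by simp
qed

section \<open>Vector fields and their gradients\<close>

lemma H10_gradient_weak_grad: "u \<in> H10 \<Omega> \<Longrightarrow> H10_gradient \<Omega> u (weak_grad \<Omega> u)"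
  using someI_ex[of "\<lambda>G. H10_gradient \<Omega> u G"] by (simp add: H10_def weak_grad_def)

lemma X_space_iff: "v \<in> X_space \<Omega> \<longleftrightarrow> (\<forall>i. \<exists>G. H10_gradient \<Omega> (\<lambda>x. v x $ i) G)"
  by (simp add: X_space_def H10_def)

lemma X_space_gradient:
  "v \<in> X_space \<Omega> \<Longrightarrow> H10_gradient \<Omega> (\<lambda>x. v x $ i) (\<lambda>x. grad \<Omega> v x $ i)"
  using H10_gradient_weak_grad[of "\<lambda>x. v x $ i" \<Omega>] by (simp add: X_space_def grad_def)

lemma grad_L2: "v \<in> X_space \<Omega> \<Longrightarrow> grad \<Omega> v \<in> L2_space \<Omega>"
  by (intro L2_space_vecI[of "grad \<Omega> v"] H10_gradientD(2)[OF X_space_gradient])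

lemma grad_norm_nonneg [simp]: "0 \<le> grad_norm \<Omega> v"
  by (simp add: grad_norm_def)

lemma L2_norm_vec_le:
  fixes G :: "'a::euclidean_space \<Rightarrow> 'b::euclidean_space^'d"
  assumes G: "\<And>j. (\<lambda>x. G x $ j) \<in> L2_space \<Omega>"
  shows "L2_norm \<Omega> G \<le> (\<Sum>j\<in>UNIV. L2_norm \<Omega> (\<lambda>x. G x $ j))"
proof -
  have "(L2_norm \<Omega> G)\<^sup>2 = (\<Sum>j\<in>UNIV. (L2_norm \<Omega> (\<lambda>x. G x $ j))\<^sup>2)"
    using G[THEN L2_inner_integrable, OF G] by (simp add: L2_norm_sq L2_inner_def inner_vec_def)
  then have "L2_norm \<Omega> G = L2_set (\<lambda>j. L2_norm \<Omega> (\<lambda>x. G x $ j)) UNIV"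
    unfolding L2_set_def by (metis L2_norm_nonneg real_sqrt_unique)
  then show ?thesis by (simp add: L2_set_le_sum)
qed

text \<open>The dimensions are those in which \<open>H\<^sup>1\<^sub>0\<close> was shown to embed into \<open>L\<^sup>4\<close>.  Differences and negatives of
  fields are written as linear combinations \<open>a *\<^sub>R v + b *\<^sub>R w\<close> throughout, so that one linearity lemma per
  argument covers sums, differences, multiples and mixtures.\<close>

locale flow_domain =
  fixes \<Omega> :: "(real^'d) set"
  assumes open_domain: "open \<Omega>" and bounded_domain: "bounded \<Omega>"
    and dimension: "CARD('d) = 2 \<or> CARD('d) = 3"
begin

lemma grad_eq_AE:
  assumes "v \<in> X_space \<Omega>" "\<And>i. H10_gradient \<Omega> (\<lambda>x. v x $ i) (\<lambda>x. G x $ i)"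
  shows "AE x in lebesgue_on \<Omega>. grad \<Omega> v x = G x"
proof -
  have "AE x in lebesgue_on \<Omega>. \<forall>i\<in>UNIV. grad \<Omega> v x $ i = G x $ i"
    by (intro AE_finite_allI H10_gradient_unique[OF open_domain X_space_gradient[OF assms(1)] assms(2)]) auto
  then show ?thesis by eventually_elim (simp add: vec_eq_iff[where x="grad \<Omega> v _"])
qed

lemma X_space_lincomb_gradient:
  assumes "v \<in> X_space \<Omega>" "w \<in> X_space \<Omega>"
  shows "H10_gradient \<Omega> (\<lambda>x. (a *\<^sub>R v x + b *\<^sub>R w x) $ i) (\<lambda>x. (a *\<^sub>R grad \<Omega> v x + b *\<^sub>R grad \<Omega> w x) $ i)"
  using H10_gradient_lincomb[OF open_domain X_space_gradient[OF assms(1), of i] X_space_gradient[OF assms(2), of i], of a b]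
  by simp

lemma X_space_lincomb:
  "v \<in> X_space \<Omega> \<Longrightarrow> w \<in> X_space \<Omega> \<Longrightarrow> (\<lambda>x. a *\<^sub>R v x + b *\<^sub>R w x) \<in> X_space \<Omega>"
  using X_space_lincomb_gradient[of v w a b] unfolding X_space_iff[of "\<lambda>x. a *\<^sub>R v x + b *\<^sub>R w x"] by blast

lemma grad_lincomb:
  assumes "v \<in> X_space \<Omega>" "w \<in> X_space \<Omega>"
  shows "AE x in lebesgue_on \<Omega>. grad \<Omega> (\<lambda>x. a *\<^sub>R v x + b *\<^sub>R w x) x = a *\<^sub>R grad \<Omega> v x + b *\<^sub>R grad \<Omega> w x"
  by (intro grad_eq_AE X_space_lincomb X_space_lincomb_gradient assms)

lemma grad_cong_AE:
  assumes "v \<in> X_space \<Omega>" "w \<in> X_space \<Omega>" "AE x in lebesgue_on \<Omega>. v x = w x"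
  shows "AE x in lebesgue_on \<Omega>. grad \<Omega> v x = grad \<Omega> w x"
proof -
  have "AE x in lebesgue_on \<Omega>. grad \<Omega> v x $ i = grad \<Omega> w x $ i" for i
  proof (rule H10_gradient_unique[OF open_domain X_space_gradient X_space_gradient])
    show "AE x in lebesgue_on \<Omega>. v x $ i = w x $ i" using assms(3) by eventually_elim simp
  qed (use assms in auto)
  then have "AE x in lebesgue_on \<Omega>. \<forall>i\<in>UNIV. grad \<Omega> v x $ i = grad \<Omega> w x $ i"
    by (intro AE_finite_allI) auto
  then show ?thesis by eventually_elim (simp add: vec_eq_iff[where x="grad \<Omega> v _"])
qed

lemma grad_inner_cong:
  assumes "v \<in> X_space \<Omega>" "w \<in> X_space \<Omega>" "z \<in> X_space \<Omega>" "AE x in lebesgue_on \<Omega>. v x = w x"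
  shows "L2_inner \<Omega> (grad \<Omega> v) (grad \<Omega> z) = L2_inner \<Omega> (grad \<Omega> w) (grad \<Omega> z)"
  by (rule L2_inner_cong_AE[OF grad_L2 grad_L2 grad_L2 grad_L2 grad_cong_AE]) (use assms in auto)

lemma grad_inner_lincomb:
  assumes "v \<in> X_space \<Omega>" "w \<in> X_space \<Omega>" "z \<in> X_space \<Omega>"
  shows "L2_inner \<Omega> (grad \<Omega> (\<lambda>x. a *\<^sub>R v x + b *\<^sub>R w x)) (grad \<Omega> z) =
     a * L2_inner \<Omega> (grad \<Omega> v) (grad \<Omega> z) + b * L2_inner \<Omega> (grad \<Omega> w) (grad \<Omega> z)"
proof -
  have "L2_inner \<Omega> (grad \<Omega> (\<lambda>x. a *\<^sub>R v x + b *\<^sub>R w x)) (grad \<Omega> z) =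
     L2_inner \<Omega> (\<lambda>x. a *\<^sub>R grad \<Omega> v x + b *\<^sub>R grad \<Omega> w x) (grad \<Omega> z)"
    by (rule L2_inner_cong_AE[OF grad_L2 L2_space_lincomb[OF grad_L2 grad_L2] grad_L2 grad_L2 grad_lincomb])
       (use assms X_space_lincomb in auto)
  then show ?thesis using assms by (simp add: L2_inner_lincomb_left grad_L2)
qed

lemma grad_norm_sq: "L2_inner \<Omega> (grad \<Omega> v) (grad \<Omega> v) = (grad_norm \<Omega> v)\<^sup>2"
  by (simp add: grad_norm_def L2_norm_sq)

lemma grad_norm_minus:
  assumes "v \<in> X_space \<Omega>"
  shows "grad_norm \<Omega> (\<lambda>x. 0 *\<^sub>R v x + (-1) *\<^sub>R v x) = grad_norm \<Omega> v"
proof -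
  let ?m = "\<lambda>x. 0 *\<^sub>R v x + (-1) *\<^sub>R v x"
  have m: "?m \<in> X_space \<Omega>" by (rule X_space_lincomb[OF assms assms])
  have "L2_inner \<Omega> (grad \<Omega> ?m) (grad \<Omega> ?m) = - L2_inner \<Omega> (grad \<Omega> v) (grad \<Omega> ?m)"
    by (subst grad_inner_lincomb[OF assms assms m]) simp
  also have "\<dots> = - L2_inner \<Omega> (grad \<Omega> ?m) (grad \<Omega> v)" by (simp only: L2_inner_commute)
  also have "\<dots> = L2_inner \<Omega> (grad \<Omega> v) (grad \<Omega> v)"
    by (subst grad_inner_lincomb[OF assms assms assms]) simp
  finally have "(grad_norm \<Omega> ?m)\<^sup>2 = (grad_norm \<Omega> v)\<^sup>2" by (simp only: grad_norm_sq)
  then show ?thesis by (rule power2_eq_imp_eq) simp_all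
qed

text \<open>Dual norms range over the fields that do not vanish almost everywhere; this lemma settles the others.\<close>

lemma grad_norm_null:
  assumes v: "v \<in> X_space \<Omega>" and "AE x in lebesgue_on \<Omega>. v x = 0"
  shows "grad_norm \<Omega> v = 0"
proof -
  let ?z = "\<lambda>x. 0 *\<^sub>R v x + 0 *\<^sub>R v x"
  have "L2_inner \<Omega> (grad \<Omega> v) (grad \<Omega> v) = L2_inner \<Omega> (grad \<Omega> ?z) (grad \<Omega> v)"
    by (rule grad_inner_cong[OF v X_space_lincomb[OF v v] v]) (use assms(2) in simp)
  also have "\<dots> = 0" by (subst grad_inner_lincomb[OF v v v]) simp
  finally show ?thesis by (simp add: grad_norm_sq)
qed

section \<open>The convection form\<close>

text \<open>Young's inequality, applied twice, bounds the product by \<open>a\<^sup>2 + b\<^sup>4 + c\<^sup>4\<close>.\<close>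

lemma triple_product_integrable:
  fixes a b c :: "real^'d \<Rightarrow> real"
  assumes [measurable]: "a \<in> L2_space \<Omega>" "b \<in> borel_measurable (lebesgue_on \<Omega>)" "c \<in> borel_measurable (lebesgue_on \<Omega>)"
    and "integrable (lebesgue_on \<Omega>) (\<lambda>x. b x ^ 4)" "integrable (lebesgue_on \<Omega>) (\<lambda>x. c x ^ 4)"
  shows "integrable (lebesgue_on \<Omega>) (\<lambda>x. a x * b x * c x)"
proof (rule Bochner_Integration.integrable_bound)
  show "integrable (lebesgue_on \<Omega>) (\<lambda>x. (norm (a x))\<^sup>2 + (b x ^ 4 + c x ^ 4))"
    using assms(4,5) L2_space_integrable[OF assms(1)] by (intro Bochner_Integration.integrable_add)
  show "AE x in lebesgue_on \<Omega>. norm (a x * b x * c x) \<le> norm ((norm (a x))\<^sup>2 + (b x ^ 4 + c x ^ 4))"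
  proof (rule AE_I2)
    fix x
    have "2 * \<bar>a x\<bar> * \<bar>b x * c x\<bar> \<le> (a x)\<^sup>2 + (b x * c x)\<^sup>2"
      using sum_squares_bound[of "\<bar>a x\<bar>" "\<bar>b x * c x\<bar>"] by simp
    moreover have "2 * (b x * c x)\<^sup>2 \<le> b x ^ 4 + c x ^ 4"
      using sum_squares_bound[of "(b x)\<^sup>2" "(c x)\<^sup>2"] by (simp add: power_mult_distrib flip: power_mult)
    moreover have "0 \<le> (a x)\<^sup>2" "0 \<le> b x ^ 4" "0 \<le> c x ^ 4" by auto
    ultimately have "\<bar>a x\<bar> * \<bar>b x * c x\<bar> \<le> (a x)\<^sup>2 + (b x ^ 4 + c x ^ 4)" by linarith
    then show "norm (a x * b x * c x) \<le> norm ((norm (a x))\<^sup>2 + (b x ^ 4 + c x ^ 4))"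
      by (simp add: abs_mult mult.assoc)
  qed
qed measurable

lemma convection_integrable:
  assumes "v \<in> X_space \<Omega>" "w \<in> X_space \<Omega>" "z \<in> X_space \<Omega>"
  shows "integrable (lebesgue_on \<Omega>) (\<lambda>x. (grad \<Omega> w x *v v x) \<bullet> z x)"
proof -
  have m: "(\<lambda>x. y x $ i) \<in> borel_measurable (lebesgue_on \<Omega>)" "integrable (lebesgue_on \<Omega>) (\<lambda>x. (y x $ i) ^ 4)"
    if "y \<in> X_space \<Omega>" for y i
    using L2_space_measurable[OF H10_gradientD(1)[OF X_space_gradient[OF that]]]
      H10_fourth_power_integrable[OF open_domain dimension X_space_gradient[OF that]] by auto
  have "integrable (lebesgue_on \<Omega>) (\<lambda>x. \<Sum>i\<in>UNIV. \<Sum>j\<in>UNIV. grad \<Omega> w x $ i $ j * v x $ j * z x $ i)"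
    by (intro Bochner_Integration.integrable_sum triple_product_integrable m assms L2_space_component
        H10_gradientD(2)[OF X_space_gradient])
  then show ?thesis by (simp add: inner_vec_def matrix_vector_mult_def sum_distrib_right)
qed

lemma convection_measurable:
  assumes "v \<in> X_space \<Omega>" "w \<in> X_space \<Omega>" "z \<in> X_space \<Omega>"
  shows "(\<lambda>x. (grad \<Omega> w x *v v x) \<bullet> z x) \<in> borel_measurable (lebesgue_on \<Omega>)"
  by (rule borel_measurable_integrable[OF convection_integrable[OF assms]])

lemma
  assumes "v \<in> X_space \<Omega>" "w \<in> X_space \<Omega>" "z \<in> X_space \<Omega>" "y \<in> X_space \<Omega>"
  shows convection_lincomb_1: "convection \<Omega> (\<lambda>x. a *\<^sub>R v x + b *\<^sub>R y x) w z = a * convection \<Omega> v w z + b * convection \<Omega> y w z"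
    and convection_lincomb_2: "convection \<Omega> v (\<lambda>x. a *\<^sub>R w x + b *\<^sub>R y x) z = a * convection \<Omega> v w z + b * convection \<Omega> v y z"
    and convection_lincomb_3: "convection \<Omega> v w (\<lambda>x. a *\<^sub>R z x + b *\<^sub>R y x) = a * convection \<Omega> v w z + b * convection \<Omega> v w y"
proof -
  show "convection \<Omega> (\<lambda>x. a *\<^sub>R v x + b *\<^sub>R y x) w z = a * convection \<Omega> v w z + b * convection \<Omega> y w z"
    using convection_integrable[OF assms(1-3)] convection_integrable[OF assms(4,2,3)]
    by (simp add: convection_def L2_inner_def matrix_vector_right_distrib matrix_vector_mult_scaleR inner_add_left)
  show "convection \<Omega> v w (\<lambda>x. a *\<^sub>R z x + b *\<^sub>R y x) = a * convection \<Omega> v w z + b * convection \<Omega> v w y"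
    using convection_integrable[OF assms(1-3)] convection_integrable[OF assms(1,2,4)]
    by (simp add: convection_def L2_inner_def inner_add_right)
  let ?wy = "\<lambda>x. a *\<^sub>R w x + b *\<^sub>R y x"
  have "convection \<Omega> v ?wy z = (LINT x|lebesgue_on \<Omega>. a * ((grad \<Omega> w x *v v x) \<bullet> z x) + b * ((grad \<Omega> y x *v v x) \<bullet> z x))"
    unfolding convection_def L2_inner_def
  proof (rule integral_cong_AE)
    show "AE x in lebesgue_on \<Omega>. (grad \<Omega> ?wy x *v v x) \<bullet> z x = a * ((grad \<Omega> w x *v v x) \<bullet> z x) + b * ((grad \<Omega> y x *v v x) \<bullet> z x)"
      using grad_lincomb[OF assms(2,4), of a b]
      by eventually_elim (simp add: matrix_vector_mult_add_rdistrib scaleR_matrix_vector_assoc[symmetric] inner_add_left)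
    show "(\<lambda>x. (grad \<Omega> ?wy x *v v x) \<bullet> z x) \<in> borel_measurable (lebesgue_on \<Omega>)"
      by (rule convection_measurable[OF assms(1) X_space_lincomb[OF assms(2,4)] assms(3)])
    show "(\<lambda>x. a * ((grad \<Omega> w x *v v x) \<bullet> z x) + b * ((grad \<Omega> y x *v v x) \<bullet> z x)) \<in> borel_measurable (lebesgue_on \<Omega>)"
      using convection_measurable[OF assms(1-3)] convection_measurable[OF assms(1,4,3)] by measurable
  qed
  also have "\<dots> = a * convection \<Omega> v w z + b * convection \<Omega> v y z"
    using convection_integrable[OF assms(1-3)] convection_integrable[OF assms(1,4,3)]
    by (simp add: convection_def L2_inner_def)
  finally show "convection \<Omega> v ?wy z = a * convection \<Omega> v w z + b * convection \<Omega> v y z" .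
qed

lemma convection_cong_AE:
  assumes "v \<in> X_space \<Omega>" "w \<in> X_space \<Omega>" "z \<in> X_space \<Omega>" "v' \<in> X_space \<Omega>" "w' \<in> X_space \<Omega>"
    and "AE x in lebesgue_on \<Omega>. v x = v' x" "AE x in lebesgue_on \<Omega>. w x = w' x"
  shows "convection \<Omega> v w z = convection \<Omega> v' w' z"
  unfolding convection_def L2_inner_def
proof (rule integral_cong_AE)
  show "AE x in lebesgue_on \<Omega>. (grad \<Omega> w x *v v x) \<bullet> z x = (grad \<Omega> w' x *v v' x) \<bullet> z x"
    using grad_cong_AE[OF assms(2,5,7)] assms(6) by eventually_elim simp
qed (intro convection_measurable assms)+

text \<open>Replacing \<open>z\<close> by \<open>- z\<close> makes the given one-sided bound two-sided.\<close>

lemma abs_convection_le: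
  assumes M: "convection_bound \<Omega> M" and "v \<in> X_space \<Omega>" "w \<in> X_space \<Omega>" "z \<in> X_space \<Omega>"
  shows "\<bar>convection \<Omega> v w z\<bar> \<le> M * grad_norm \<Omega> v * grad_norm \<Omega> w * grad_norm \<Omega> z"
proof -
  let ?m = "\<lambda>x. 0 *\<^sub>R z x + (-1) *\<^sub>R z x"
  have b: "convection \<Omega> v w y \<le> M * grad_norm \<Omega> v * grad_norm \<Omega> w * grad_norm \<Omega> y" if "y \<in> X_space \<Omega>" for y
    using M assms(2,3) that unfolding convection_bound_def by blast
  have "convection \<Omega> v w ?m = - convection \<Omega> v w z"
    by (subst convection_lincomb_3[OF assms(2-4,4)]) simp
  then show ?thesis
    using b[OF assms(4)] b[OF X_space_lincomb[OF assms(4,4), of 0 "-1"]] grad_norm_minus[OF assms(4)] by simp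
qed

section \<open>Divergence-free fields and skew-symmetry\<close>

lemma divergence_L2:
  assumes "v \<in> X_space \<Omega>" shows "divergence \<Omega> v \<in> L2_space \<Omega>"
proof -
  have c: "(\<lambda>x. grad \<Omega> v x $ i $ i) \<in> L2_space \<Omega>" for i
    by (rule L2_space_component[OF H10_gradientD(2)[OF X_space_gradient[OF assms]]])
  have "(\<lambda>x. \<Sum>i\<in>I. grad \<Omega> v x $ i $ i) \<in> L2_space \<Omega>" if "finite I" for I
    using that
  proof induction
    case empty
    then show ?case by (simp add: L2_space_def)
  next
    case (insert i I)
    then show ?case using L2_space_lincomb[OF c[of i] insert.IH, of 1 1] by simp
  qed
  from this[of UNIV] show ?thesis by (simp add: divergence_def[abs_def])
qed

lemma V_space_X: "v \<in> V_space \<Omega> \<Longrightarrow> v \<in> X_space \<Omega>"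
  by (simp add: V_space_def)

lemma V_space_lincomb:
  assumes "v \<in> V_space \<Omega>" "w \<in> V_space \<Omega>"
  shows "(\<lambda>x. a *\<^sub>R v x + b *\<^sub>R w x) \<in> V_space \<Omega>"
proof -
  let ?y = "\<lambda>x. a *\<^sub>R v x + b *\<^sub>R w x"
  note X = assms[THEN V_space_X]
  have y: "?y \<in> X_space \<Omega>" by (rule X_space_lincomb[OF X])
  have "AE x in lebesgue_on \<Omega>. divergence \<Omega> ?y x = a *\<^sub>R divergence \<Omega> v x + b *\<^sub>R divergence \<Omega> w x"
    using grad_lincomb[OF X, of a b] by eventually_elim (simp add: divergence_def sum.distrib sum_distrib_left)
  then have "L2_inner \<Omega> (divergence \<Omega> ?y) q = 0" if q: "q \<in> Q_space \<Omega>" for q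
  proof -
    have q2: "q \<in> L2_space \<Omega>" using q by (simp add: Q_space_def)
    have "L2_inner \<Omega> (divergence \<Omega> ?y) q = L2_inner \<Omega> (\<lambda>x. a *\<^sub>R divergence \<Omega> v x + b *\<^sub>R divergence \<Omega> w x) q"
      by (rule L2_inner_cong_AE[OF divergence_L2[OF y] L2_space_lincomb q2 q2])
         (use \<open>AE x in _. _ = _\<close> divergence_L2 X in auto)
    also have "\<dots> = 0"
      using assms q by (subst L2_inner_lincomb_left) (auto simp: V_space_def divergence_L2 q2)
    finally show ?thesis .
  qed
  then show ?thesis using y by (simp add: V_space_def)
qed

text \<open>The divergence has mean zero, because its summands are limits of derivatives of test functions.
  So it belongs to \<open>Q\<close> and is orthogonal to itself.\<close>

lemma V_space_divergence_zero:
  assumes "v \<in> V_space \<Omega>"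
  shows "AE x in lebesgue_on \<Omega>. divergence \<Omega> v x = 0"
proof (rule L2_norm_eq_0_imp_AE)
  note X = V_space_X[OF assms]
  show D: "divergence \<Omega> v \<in> L2_space \<Omega>" by (rule divergence_L2[OF X])
  have "integrable (lebesgue_on \<Omega>) (\<lambda>x. grad \<Omega> v x $ i $ i)" for i
    using L2_inner_integrable[OF L2_space_component[OF H10_gradientD(2)[OF X_space_gradient[OF X]]]
        const_L2[OF open_domain bounded_domain, of 1]] by simp
  then have "(LINT x|lebesgue_on \<Omega>. divergence \<Omega> v x) = 0"
    using H10_gradient_integral_zero[OF open_domain bounded_domain X_space_gradient[OF X]]
    by (simp add: divergence_def)
  then have "L2_inner \<Omega> (divergence \<Omega> v) (divergence \<Omega> v) = 0"
    using assms D by (auto simp: V_space_def Q_space_def)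
  then show "L2_norm \<Omega> (divergence \<Omega> v) = 0" by (simp add: L2_norm_def)
qed

lemma test_field_gradient:
  assumes "\<And>i. (\<lambda>x. \<Phi> x $ i) \<in> test_functions \<Omega>"
  shows "\<Phi> \<in> X_space \<Omega>" and "AE x in lebesgue_on \<Omega>. grad \<Omega> \<Phi> x = (\<chi> i j. partial j (\<lambda>x. \<Phi> x $ i) x)"
proof -
  have g: "H10_gradient \<Omega> (\<lambda>x. \<Phi> x $ i) (\<lambda>x. (\<chi> i j. partial j (\<lambda>x. \<Phi> x $ i) x) $ i)" for i
    using H10_gradient_test_function[OF open_domain assms[of i]] by simp
  then show "\<Phi> \<in> X_space \<Omega>" unfolding X_space_iff by blast
  then show "AE x in lebesgue_on \<Omega>. grad \<Omega> \<Phi> x = (\<chi> i j. partial j (\<lambda>x. \<Phi> x $ i) x)"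
    using g by (rule grad_eq_AE)
qed

text \<open>Since \<open>(v \<cdot> \<nabla>\<Phi>) \<cdot> \<Phi> = v \<cdot> \<nabla>(\<bar>\<Phi>\<bar>\<^sup>2) / 2\<close>, integrating by parts moves the derivative to the
  divergence of \<open>v\<close>.\<close>

lemma convection_test_field:
  assumes v: "v \<in> V_space \<Omega>" and \<Phi>: "\<And>i. (\<lambda>x. \<Phi> x $ i) \<in> test_functions \<Omega>"
  shows "convection \<Omega> v \<Phi> \<Phi> = 0"
proof -
  note X = V_space_X[OF v] and FX = test_field_gradient(1)[OF \<Phi>]
  define \<psi> where "\<psi> i x = \<Phi> x $ i * \<Phi> x $ i" for i x
  have \<psi>: "\<psi> i \<in> test_functions \<Omega>" for i
    unfolding \<psi>_def[abs_def] by (rule test_function_mult[OF \<Phi> \<Phi>])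
  have d\<psi>: "partial j (\<psi> i) x = 2 * (partial j (\<lambda>x. \<Phi> x $ i) x * \<Phi> x $ i)" for i j x
    unfolding \<psi>_def[abs_def]
    using partial_mult[OF test_function_differentiable[OF \<Phi>[of i]] test_function_differentiable[OF \<Phi>[of i]], of j x] by simp
  have i1: "integrable (lebesgue_on \<Omega>) (\<lambda>x. v x $ j * partial j (\<psi> i) x)" for i j
    using L2_inner_integrable[OF H10_gradientD(1)[OF X_space_gradient[OF X, of j]]
        test_function_L2[OF open_domain test_function_partial[OF \<psi>]], of j i] by simp
  have i2: "integrable (lebesgue_on \<Omega>) (\<lambda>x. grad \<Omega> v x $ j $ j * \<psi> i x)" for i j
    using L2_inner_integrable[OF L2_space_component[OF H10_gradientD(2)[OF X_space_gradient[OF X, of j]]]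
        test_function_L2[OF open_domain \<psi>], of j i] by simp
  have "(\<Sum>j\<in>UNIV. LINT x|lebesgue_on \<Omega>. v x $ j * partial j (\<psi> i) x) = 0" for i
  proof -
    have "(\<Sum>j\<in>UNIV. LINT x|lebesgue_on \<Omega>. v x $ j * partial j (\<psi> i) x) =
        (\<Sum>j\<in>UNIV. - (LINT x|lebesgue_on \<Omega>. grad \<Omega> v x $ j $ j * \<psi> i x))"
      using H10_gradientD(3)[OF X_space_gradient[OF X]] \<psi> unfolding has_weak_gradient_def
      by (intro sum.cong) auto
    also have "\<dots> = - (LINT x|lebesgue_on \<Omega>. divergence \<Omega> v x * \<psi> i x)"
      using i2 by (simp add: sum_negf divergence_def sum_distrib_right)
    also have "(LINT x|lebesgue_on \<Omega>. divergence \<Omega> v x * \<psi> i x) = 0"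
      using V_space_divergence_zero[OF v] by (intro integral_eq_zero_AE) auto
    finally show ?thesis by simp
  qed
  moreover have "convection \<Omega> v \<Phi> \<Phi> = (LINT x|lebesgue_on \<Omega>. (\<Sum>i\<in>UNIV. \<Sum>j\<in>UNIV. v x $ j * partial j (\<psi> i) x) / 2)"
    unfolding convection_def L2_inner_def
  proof (rule integral_cong_AE)
    show "(\<lambda>x. (grad \<Omega> \<Phi> x *v v x) \<bullet> \<Phi> x) \<in> borel_measurable (lebesgue_on \<Omega>)"
      by (rule convection_measurable[OF X FX FX])
    show "(\<lambda>x. (\<Sum>i\<in>UNIV. \<Sum>j\<in>UNIV. v x $ j * partial j (\<psi> i) x) / 2) \<in> borel_measurable (lebesgue_on \<Omega>)"
      using i1[THEN borel_measurable_integrable] by measurable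
    show "AE x in lebesgue_on \<Omega>. (grad \<Omega> \<Phi> x *v v x) \<bullet> \<Phi> x = (\<Sum>i\<in>UNIV. \<Sum>j\<in>UNIV. v x $ j * partial j (\<psi> i) x) / 2"
      using test_field_gradient(2)[OF \<Phi>]
    proof eventually_elim
      fix x assume g: "grad \<Omega> \<Phi> x = (\<chi> i j. partial j (\<lambda>x. \<Phi> x $ i) x)"
      show "(grad \<Omega> \<Phi> x *v v x) \<bullet> \<Phi> x = (\<Sum>i\<in>UNIV. \<Sum>j\<in>UNIV. v x $ j * partial j (\<psi> i) x) / 2"
        unfolding g
        by (simp add: inner_vec_def matrix_vector_mult_def sum_distrib_right sum_distrib_left sum_divide_distrib d\<psi> ac_simps)
    qed
  qed
  ultimately show ?thesis using i1 by simp
qed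

lemma test_field_approximation:
  assumes e: "e \<in> X_space \<Omega>"
  shows "\<exists>\<Phi>. (\<forall>n::nat. \<forall>i. (\<lambda>x. \<Phi> n x $ i) \<in> test_functions \<Omega>) \<and>
     (\<lambda>n. grad_norm \<Omega> (\<lambda>x. 1 *\<^sub>R e x + (-1) *\<^sub>R \<Phi> n x)) \<longlonglongrightarrow> 0"
proof -
  have ch: "\<forall>i. \<exists>\<phi>. (\<forall>n::nat. \<phi> n \<in> test_functions \<Omega>) \<and>
     (\<lambda>n. L2_norm \<Omega> (\<lambda>x. (\<chi> j. partial j (\<phi> n) x) - grad \<Omega> e x $ i)) \<longlonglongrightarrow> 0"
    using H10_gradientD(4)[OF X_space_gradient[OF e]] by blast
  from choice[OF ch] obtain \<phi> where \<phi>: "\<And>i n. \<phi> i n \<in> test_functions \<Omega>"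
     "\<And>i. (\<lambda>n. L2_norm \<Omega> (\<lambda>x. (\<chi> j. partial j (\<phi> i n) x) - grad \<Omega> e x $ i)) \<longlonglongrightarrow> 0"
    by blast
  define \<Phi> where "\<Phi> n x = (\<chi> i. \<phi> i n x)" for n x
  have \<Phi>: "(\<lambda>x. \<Phi> n x $ i) \<in> test_functions \<Omega>" for n i by (simp add: \<Phi>_def \<phi>(1))
  have bound: "grad_norm \<Omega> (\<lambda>x. 1 *\<^sub>R e x + (-1) *\<^sub>R \<Phi> n x) \<le>
     (\<Sum>i\<in>UNIV. L2_norm \<Omega> (\<lambda>x. (\<chi> j. partial j (\<phi> i n) x) - grad \<Omega> e x $ i))" for n
  proof -
    let ?d = "\<lambda>x. 1 *\<^sub>R e x + (-1) *\<^sub>R \<Phi> n x"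
    let ?G = "\<lambda>x. \<chi> i. grad \<Omega> e x $ i - (\<chi> j. partial j (\<phi> i n) x)"
    note FX = test_field_gradient[OF \<Phi>, of n]
    have d: "?d \<in> X_space \<Omega>" by (rule X_space_lincomb[OF e FX(1)])
    have G: "(\<lambda>x. ?G x $ i) \<in> L2_space \<Omega>" for i
      using L2_space_diff[OF H10_gradientD(2)[OF X_space_gradient[OF e, of i]] test_function_grad_L2[OF open_domain \<phi>(1)[of i n]]]
      by simp
    have "AE x in lebesgue_on \<Omega>. grad \<Omega> ?d x = ?G x"
      using FX(2) grad_lincomb[OF e FX(1), of 1 "-1"]
      by eventually_elim (simp add: vec_eq_iff \<Phi>_def)
    then have "grad_norm \<Omega> ?d = L2_norm \<Omega> ?G"
      unfolding grad_norm_def L2_norm_def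
      using L2_inner_cong_AE[OF grad_L2[OF d] L2_space_vecI[OF G] grad_L2[OF d] L2_space_vecI[OF G]] by simp
    also have "\<dots> \<le> (\<Sum>i\<in>UNIV. L2_norm \<Omega> (\<lambda>x. ?G x $ i))" by (rule L2_norm_vec_le[OF G])
    finally show ?thesis using L2_norm_minus_commute[of \<Omega> "\<lambda>x. grad \<Omega> e x $ _"] by simp
  qed
  have "(\<lambda>n. grad_norm \<Omega> (\<lambda>x. 1 *\<^sub>R e x + (-1) *\<^sub>R \<Phi> n x)) \<longlonglongrightarrow> 0"
  proof (rule tendsto_sandwich[of "\<lambda>_. 0"])
    show "(\<lambda>n. \<Sum>i\<in>UNIV. L2_norm \<Omega> (\<lambda>x. (\<chi> j. partial j (\<phi> i n) x) - grad \<Omega> e x $ i)) \<longlonglongrightarrow> 0"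
      using tendsto_sum[of UNIV, OF \<phi>(2)] by simp
  qed (use bound in \<open>auto intro: always_eventually\<close>)
  then show ?thesis using \<Phi> by blast
qed

text \<open>Convection is continuous in the \<open>\<parallel>\<nabla>\<cdot>\<parallel>\<close> norm by the assumed bound, and it vanishes on the diagonal for the
  dense set of test fields.\<close>

lemma convection_skew:
  assumes M: "convection_bound \<Omega> M" and v: "v \<in> V_space \<Omega>" and e: "e \<in> X_space \<Omega>"
  shows "convection \<Omega> v e e = 0"
proof -
  note X = V_space_X[OF v]
  obtain \<Phi> where \<Phi>: "\<And>n i. (\<lambda>x. \<Phi> n x $ i) \<in> test_functions \<Omega>"
     "(\<lambda>n. grad_norm \<Omega> (\<lambda>x. 1 *\<^sub>R e x + (-1) *\<^sub>R \<Phi> n x)) \<longlonglongrightarrow> 0"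
    using test_field_approximation[OF e] by blast
  define d where "d n x = 1 *\<^sub>R e x + (-1) *\<^sub>R \<Phi> n x" for n :: nat and x
  have FX: "\<Phi> n \<in> X_space \<Omega>" for n by (rule test_field_gradient(1)[OF \<Phi>(1)])
  have dX: "d n \<in> X_space \<Omega>" for n unfolding d_def[abs_def] by (rule X_space_lincomb[OF e FX])
  let ?b = "\<lambda>n. M * grad_norm \<Omega> v * (2 * grad_norm \<Omega> e * grad_norm \<Omega> (d n) + (grad_norm \<Omega> (d n))\<^sup>2)"
  have "\<bar>convection \<Omega> v e e\<bar> \<le> ?b n" for n
  proof -
    have F: "\<Phi> n = (\<lambda>x. 1 *\<^sub>R e x + (-1) *\<^sub>R d n x)" by (simp add: d_def fun_eq_iff)
    have left: "convection \<Omega> v (\<Phi> n) z = convection \<Omega> v e z - convection \<Omega> v (d n) z" if "z \<in> X_space \<Omega>" for z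
      unfolding F convection_lincomb_2[OF X e that dX] by simp
    have right: "convection \<Omega> v z (\<Phi> n) = convection \<Omega> v z e - convection \<Omega> v z (d n)" if "z \<in> X_space \<Omega>" for z
      unfolding F convection_lincomb_3[OF X that e dX] by simp
    have "0 = convection \<Omega> v (\<Phi> n) (\<Phi> n)" by (rule convection_test_field[OF v \<Phi>(1), symmetric])
    also have "\<dots> = convection \<Omega> v e e - convection \<Omega> v e (d n) - (convection \<Omega> v (d n) e - convection \<Omega> v (d n) (d n))"
      using left[OF FX] right[OF e] right[OF dX] by simp
    finally have "convection \<Omega> v e e = convection \<Omega> v e (d n) + convection \<Omega> v (d n) e - convection \<Omega> v (d n) (d n)" by simp
    then have "\<bar>convection \<Omega> v e e\<bar> \<le> \<bar>convection \<Omega> v e (d n)\<bar> + \<bar>convection \<Omega> v (d n) e\<bar> + \<bar>convection \<Omega> v (d n) (d n)\<bar>"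
      by linarith
    also have "\<dots> \<le> M * grad_norm \<Omega> v * grad_norm \<Omega> e * grad_norm \<Omega> (d n) + M * grad_norm \<Omega> v * grad_norm \<Omega> (d n) * grad_norm \<Omega> e
        + M * grad_norm \<Omega> v * grad_norm \<Omega> (d n) * grad_norm \<Omega> (d n)"
      by (intro add_mono abs_convection_le[OF M] X e dX)
    also have "\<dots> = ?b n" by (simp add: algebra_simps power2_eq_square)
    finally show ?thesis .
  qed
  moreover have "?b \<longlonglongrightarrow> M * grad_norm \<Omega> v * (2 * grad_norm \<Omega> e * 0 + 0\<^sup>2)"
    using \<Phi>(2) unfolding d_def[abs_def] by (intro tendsto_intros)
  ultimately have "\<bar>convection \<Omega> v e e\<bar> \<le> M * grad_norm \<Omega> v * (2 * grad_norm \<Omega> e * 0 + 0\<^sup>2)"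
    by (intro LIMSEQ_le_const) auto
  then show ?thesis by simp
qed

end

section \<open>Dual norms and residuals\<close>

lemma le_of_mult_self_le:
  fixes c g N :: real
  assumes "0 \<le> g" "0 \<le> N" "c * g * g \<le> N * g"
  shows "c * g \<le> N"
  using assms by (cases "g = 0") (auto simp: mult_le_cancel_right)

context flow_domain begin

text \<open>For unbounded \<open>F\<close> the supremum is meaningless, so estimating \<open>F w\<close> by the dual norm requires a bound.
  Fields with \<open>\<parallel>\<nabla>w\<parallel> = 0\<close> contribute the quotient \<open>0\<close>.\<close>

lemma dual_norm_bdd_above:
  assumes "\<And>w. w \<in> W \<Longrightarrow> \<bar>F w\<bar> \<le> C * grad_norm \<Omega> w"
  shows "bdd_above (insert 0 {F w / grad_norm \<Omega> w | w. w \<in> W \<and> \<not> (AE x in lebesgue_on \<Omega>. w x = 0)})"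
proof (rule bdd_aboveI)
  fix y assume "y \<in> insert 0 {F w / grad_norm \<Omega> w | w. w \<in> W \<and> \<not> (AE x in lebesgue_on \<Omega>. w x = 0)}"
  then consider "y = 0" | w where "w \<in> W" "y = F w / grad_norm \<Omega> w" by blast
  then show "y \<le> \<bar>C\<bar>"
  proof cases
    case (2 w)
    have "F w \<le> \<bar>C\<bar> * grad_norm \<Omega> w"
      using assms[OF 2(1)] mult_right_mono[OF abs_ge_self[of C] grad_norm_nonneg[of \<Omega> w]] by linarith
    then show ?thesis
      unfolding 2(2) by (cases "grad_norm \<Omega> w = 0") (auto simp: divide_le_eq order.strict_iff_order)
  qed simp
qed

lemma dual_norm_nonneg:
  assumes "\<And>w. w \<in> W \<Longrightarrow> \<bar>F w\<bar> \<le> C * grad_norm \<Omega> w"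
  shows "0 \<le> dual_norm \<Omega> W F"
  unfolding dual_norm_def by (rule cSup_upper[OF _ dual_norm_bdd_above[OF assms]]) auto

lemma le_dual_norm_mult:
  assumes F: "\<And>w. w \<in> W \<Longrightarrow> \<bar>F w\<bar> \<le> C * grad_norm \<Omega> w" and W: "W \<subseteq> X_space \<Omega>" and w: "w \<in> W"
  shows "F w \<le> dual_norm \<Omega> W F * grad_norm \<Omega> w"
proof (cases "grad_norm \<Omega> w = 0")
  case True
  then show ?thesis using F[OF w] by simp
next
  case False
  then have "\<not> (AE x in lebesgue_on \<Omega>. w x = 0)" using grad_norm_null W w by blast
  then have "F w / grad_norm \<Omega> w \<le> dual_norm \<Omega> W F"
    unfolding dual_norm_def using w by (intro cSup_upper[OF _ dual_norm_bdd_above[OF F]]) blast+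
  moreover have "grad_norm \<Omega> w > 0" using False by (simp add: order.strict_iff_order)
  ultimately show ?thesis by (simp add: divide_le_eq)
qed

lemma dual_norm_le:
  assumes "0 \<le> C" "\<And>w. w \<in> W \<Longrightarrow> F w \<le> C * grad_norm \<Omega> w"
  shows "dual_norm \<Omega> W F \<le> C"
  unfolding dual_norm_def
proof (rule cSup_least)
  fix y assume "y \<in> insert 0 {F w / grad_norm \<Omega> w | w. w \<in> W \<and> \<not> (AE x in lebesgue_on \<Omega>. w x = 0)}"
  then consider "y = 0" | w where "w \<in> W" "y = F w / grad_norm \<Omega> w" by blast
  then show "y \<le> C"
  proof cases
    case (2 w)
    show ?thesis
      unfolding 2(2) using assms(1) assms(2)[OF 2(1)]
      by (cases "grad_norm \<Omega> w = 0") (auto simp: divide_le_eq order.strict_iff_order)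
  qed (use assms in simp)
qed simp

text \<open>Each of the three terms is continuous in \<open>z\<close>: by Cauchy-Schwarz, by the convection bound and by
  \<open>f \<in> H\<^sup>-\<^sup>1\<close>.  Hence a residual may be estimated by its dual norm.\<close>

lemma residual_bounded:
  assumes M: "convection_bound \<Omega> M" and f: "f \<in> Hm1 \<Omega>" and v: "v \<in> V_space \<Omega>"
  shows "\<exists>C. \<forall>z\<in>V_space \<Omega>. \<bar>residual \<Omega> \<nu> f v z\<bar> \<le> C * grad_norm \<Omega> z"
proof -
  obtain C where C: "\<forall>z\<in>X_space \<Omega>. \<bar>f z\<bar> \<le> C * grad_norm \<Omega> z" using f unfolding Hm1_def by blast
  note X = V_space_X[OF v]
  have "\<bar>residual \<Omega> \<nu> f v z\<bar> \<le> (\<bar>\<nu>\<bar> * grad_norm \<Omega> v + M * grad_norm \<Omega> v * grad_norm \<Omega> v + C) * grad_norm \<Omega> z"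
    if z: "z \<in> V_space \<Omega>" for z
  proof -
    have "\<bar>\<nu> * L2_inner \<Omega> (grad \<Omega> v) (grad \<Omega> z)\<bar> \<le> \<bar>\<nu>\<bar> * (grad_norm \<Omega> v * grad_norm \<Omega> z)"
      unfolding abs_mult grad_norm_def by (intro mult_left_mono L2_Cauchy_Schwarz grad_L2 X V_space_X[OF z]) simp
    moreover have "\<bar>convection \<Omega> v v z\<bar> \<le> M * grad_norm \<Omega> v * grad_norm \<Omega> v * grad_norm \<Omega> z"
      by (rule abs_convection_le[OF M X X V_space_X[OF z]])
    moreover have "\<bar>f z\<bar> \<le> C * grad_norm \<Omega> z" using C V_space_X[OF z] by blast
    ultimately show ?thesis unfolding residual_def distrib_right mult.assoc by linarith
  qed
  then show ?thesis by blast
qed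

lemma residual_norm_nonneg:
  assumes "convection_bound \<Omega> M" "f \<in> Hm1 \<Omega>" "v \<in> V_space \<Omega>"
  shows "0 \<le> V_dual_norm \<Omega> (residual \<Omega> \<nu> f v)"
  using residual_bounded[OF assms, of \<nu>] dual_norm_nonneg[of "V_space \<Omega>"] unfolding V_dual_norm_def by blast

lemma residual_le:
  assumes "convection_bound \<Omega> M" "f \<in> Hm1 \<Omega>" "v \<in> V_space \<Omega>" "z \<in> V_space \<Omega>"
  shows "residual \<Omega> \<nu> f v z \<le> V_dual_norm \<Omega> (residual \<Omega> \<nu> f v) * grad_norm \<Omega> z"
proof -
  obtain C where "\<And>z. z \<in> V_space \<Omega> \<Longrightarrow> \<bar>residual \<Omega> \<nu> f v z\<bar> \<le> C * grad_norm \<Omega> z"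
    using residual_bounded[OF assms(1-3), of \<nu>] by blast
  then show ?thesis unfolding V_dual_norm_def
    by (rule le_dual_norm_mult) (use V_space_X assms(4) in auto)
qed

lemma mixed_residual_bounded:
  assumes "convection_bound \<Omega> M" "f \<in> Hm1 \<Omega>" "v \<in> V_space \<Omega>" "w \<in> V_space \<Omega>"
  shows "\<exists>C. \<forall>z\<in>V_space \<Omega>. \<bar>a * residual \<Omega> \<nu> f w z + (1 - a) * residual \<Omega> \<nu> f v z\<bar> \<le> C * grad_norm \<Omega> z"
proof -
  obtain B C where BC: "\<forall>z\<in>V_space \<Omega>. \<bar>residual \<Omega> \<nu> f w z\<bar> \<le> B * grad_norm \<Omega> z"
      "\<forall>z\<in>V_space \<Omega>. \<bar>residual \<Omega> \<nu> f v z\<bar> \<le> C * grad_norm \<Omega> z"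
    using residual_bounded[OF assms(1,2,3), of \<nu>] residual_bounded[OF assms(1,2,4), of \<nu>] by blast
  have "\<bar>a * residual \<Omega> \<nu> f w z + (1 - a) * residual \<Omega> \<nu> f v z\<bar> \<le> (\<bar>a\<bar> * B + \<bar>1 - a\<bar> * C) * grad_norm \<Omega> z"
    if z: "z \<in> V_space \<Omega>" for z
  proof -
    have "\<bar>a * residual \<Omega> \<nu> f w z\<bar> \<le> \<bar>a\<bar> * (B * grad_norm \<Omega> z)"
      unfolding abs_mult using BC(1) z by (intro mult_left_mono) auto
    moreover have "\<bar>(1 - a) * residual \<Omega> \<nu> f v z\<bar> \<le> \<bar>1 - a\<bar> * (C * grad_norm \<Omega> z)"
      unfolding abs_mult using BC(2) z by (intro mult_left_mono) auto
    ultimately show ?thesis unfolding distrib_right mult.assoc by linarith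
  qed
  then show ?thesis by blast
qed

lemma mixed_residual_norm_nonneg:
  assumes "convection_bound \<Omega> M" "f \<in> Hm1 \<Omega>" "v \<in> V_space \<Omega>" "w \<in> V_space \<Omega>"
  shows "0 \<le> mixed_residual_norm \<Omega> \<nu> f w v a"
proof -
  obtain C where "\<And>z. z \<in> V_space \<Omega> \<Longrightarrow> \<bar>a * residual \<Omega> \<nu> f w z + (1 - a) * residual \<Omega> \<nu> f v z\<bar> \<le> C * grad_norm \<Omega> z"
    using mixed_residual_bounded[OF assms, of a \<nu>] by blast
  then show ?thesis unfolding mixed_residual_norm_def V_dual_norm_def by (rule dual_norm_nonneg)
qed

lemma mixed_residual_le:
  assumes "convection_bound \<Omega> M" "f \<in> Hm1 \<Omega>" "v \<in> V_space \<Omega>" "w \<in> V_space \<Omega>" "z \<in> V_space \<Omega>"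
  shows "a * residual \<Omega> \<nu> f w z + (1 - a) * residual \<Omega> \<nu> f v z \<le> mixed_residual_norm \<Omega> \<nu> f w v a * grad_norm \<Omega> z"
proof -
  obtain C where "\<And>z. z \<in> V_space \<Omega> \<Longrightarrow> \<bar>a * residual \<Omega> \<nu> f w z + (1 - a) * residual \<Omega> \<nu> f v z\<bar> \<le> C * grad_norm \<Omega> z"
    using mixed_residual_bounded[OF assms(1-4), of a \<nu>] by blast
  from le_dual_norm_mult[OF this, of "V_space \<Omega>"] show ?thesis
    unfolding mixed_residual_norm_def V_dual_norm_def using V_space_X assms(5) by blast
qed

lemma Hm1_norm_nonneg: "f \<in> Hm1 \<Omega> \<Longrightarrow> 0 \<le> Hm1_norm \<Omega> f"
  using dual_norm_nonneg[of "X_space \<Omega>" f] unfolding Hm1_norm_def Hm1_def by blast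

lemma Hm1_le:
  assumes "f \<in> Hm1 \<Omega>" "v \<in> X_space \<Omega>"
  shows "f v \<le> Hm1_norm \<Omega> f * grad_norm \<Omega> v"
proof -
  obtain C where "\<And>v. v \<in> X_space \<Omega> \<Longrightarrow> \<bar>f v\<bar> \<le> C * grad_norm \<Omega> v" using assms(1) unfolding Hm1_def by blast
  from le_dual_norm_mult[OF this, of "X_space \<Omega>" v] show ?thesis
    unfolding Hm1_norm_def using assms(2) by blast
qed

section \<open>One step of the iteration\<close>

text \<open>Test the equation with the solution itself; the convective term drops out.\<close>

lemma picard_solution_norm_le:
  assumes M: "convection_bound \<Omega> M" and f: "f \<in> Hm1 \<Omega>" and \<nu>: "\<nu> > 0"
    and v: "v \<in> V_space \<Omega>" and w: "picard_solution \<Omega> \<nu> f v w"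
  shows "\<nu> * grad_norm \<Omega> w \<le> Hm1_norm \<Omega> f"
proof -
  have wV: "w \<in> V_space \<Omega>" using w by (simp add: picard_solution_def)
  note wX = V_space_X[OF wV]
  have "\<nu> * (grad_norm \<Omega> w)\<^sup>2 = f w"
    using w wV convection_skew[OF M v wX] unfolding picard_solution_def grad_norm_sq[symmetric] by force
  also have "\<dots> \<le> Hm1_norm \<Omega> f * grad_norm \<Omega> w" by (rule Hm1_le[OF f wX])
  finally have "\<nu> * grad_norm \<Omega> w * grad_norm \<Omega> w \<le> Hm1_norm \<Omega> f * grad_norm \<Omega> w"
    by (simp add: power2_eq_square mult.assoc)
  then show ?thesis by (rule le_of_mult_self_le[OF grad_norm_nonneg Hm1_norm_nonneg[OF f]])
qed

text \<open>On \<open>V\<close> the residual of \<open>v\<close> is \<open>- \<nu> (\<nabla>e, \<nabla>\<cdot>) - (v \<cdot> \<nabla>e, \<cdot>)\<close> for the increment \<open>e\<close>; at \<open>- e\<close> its value is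
  \<open>\<nu> \<parallel>\<nabla>e\<parallel>\<^sup>2\<close>.\<close>

lemma picard_increment_norm_le:
  assumes M: "convection_bound \<Omega> M" and f: "f \<in> Hm1 \<Omega>" and \<nu>: "\<nu> > 0"
    and v: "v \<in> V_space \<Omega>" and w: "picard_solution \<Omega> \<nu> f v w"
  shows "\<nu> * grad_norm \<Omega> (\<lambda>x. 1 *\<^sub>R w x + (-1) *\<^sub>R v x) \<le> V_dual_norm \<Omega> (residual \<Omega> \<nu> f v)"
proof -
  let ?e = "\<lambda>x. 1 *\<^sub>R w x + (-1) *\<^sub>R v x" and ?N = "V_dual_norm \<Omega> (residual \<Omega> \<nu> f v)"
  let ?m = "\<lambda>x. 0 *\<^sub>R ?e x + (-1) *\<^sub>R ?e x"
  have wV: "w \<in> V_space \<Omega>" using w by (simp add: picard_solution_def)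
  have eV: "?e \<in> V_space \<Omega>" by (rule V_space_lincomb[OF wV v])
  have mV: "?m \<in> V_space \<Omega>" by (rule V_space_lincomb[OF eV eV])
  note vX = V_space_X[OF v] and wX = V_space_X[OF wV] and eX = V_space_X[OF eV] and mX = V_space_X[OF mV]
  have picard: "f ?m = \<nu> * L2_inner \<Omega> (grad \<Omega> w) (grad \<Omega> ?m) + convection \<Omega> v w ?m"
    using w mV unfolding picard_solution_def by (intro sym[of _ "f ?m"]) blast
  have grad_e: "L2_inner \<Omega> (grad \<Omega> ?e) (grad \<Omega> ?m) =
      1 * L2_inner \<Omega> (grad \<Omega> w) (grad \<Omega> ?m) + (-1) * L2_inner \<Omega> (grad \<Omega> v) (grad \<Omega> ?m)"
    by (rule grad_inner_lincomb[OF wX vX mX])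
  have grad_m: "L2_inner \<Omega> (grad \<Omega> ?e) (grad \<Omega> ?m) = - (grad_norm \<Omega> ?e)\<^sup>2"
    using grad_inner_lincomb[OF eX eX eX, of 0 "-1"] L2_inner_commute[of \<Omega> "grad \<Omega> ?e" "grad \<Omega> ?m"]
      grad_norm_sq[of ?e] by linarith
  have conv_e: "convection \<Omega> v ?e ?m = 1 * convection \<Omega> v w ?m + (-1) * convection \<Omega> v v ?m"
    by (rule convection_lincomb_2[OF vX wX mX vX])
  have conv_m: "convection \<Omega> v ?e ?m = 0"
    unfolding convection_lincomb_3[OF vX eX eX eX] convection_skew[OF M v eX] by simp
  have "\<nu> * (grad_norm \<Omega> ?e)\<^sup>2 = - (\<nu> * L2_inner \<Omega> (grad \<Omega> ?e) (grad \<Omega> ?m) + convection \<Omega> v ?e ?m)"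
    unfolding grad_m conv_m by simp
  also have "\<dots> = residual \<Omega> \<nu> f v ?m"
    unfolding residual_def picard grad_e conv_e distrib_left by linarith
  also have "\<dots> \<le> ?N * grad_norm \<Omega> ?e"
    using residual_le[OF M f v mV, of \<nu>] unfolding grad_norm_minus[OF eX] .
  finally have "\<nu> * grad_norm \<Omega> ?e * grad_norm \<Omega> ?e \<le> ?N * grad_norm \<Omega> ?e"
    by (simp add: power2_eq_square mult.assoc)
  then show ?thesis by (rule le_of_mult_self_le[OF grad_norm_nonneg residual_norm_nonneg[OF M f v]])
qed

text \<open>By the Picard equation the residual of \<open>w\<close> is \<open>(e \<cdot> \<nabla>w, \<cdot>)\<close>, and both factors have been bounded.\<close>

lemma picard_residual_le:
  assumes M: "convection_bound \<Omega> M" and f: "f \<in> Hm1 \<Omega>" and \<nu>: "\<nu> > 0" and M0: "M \<ge> 0"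
    and v: "v \<in> V_space \<Omega>" and w: "picard_solution \<Omega> \<nu> f v w"
  shows "V_dual_norm \<Omega> (residual \<Omega> \<nu> f w) \<le> kappa \<Omega> M \<nu> f * V_dual_norm \<Omega> (residual \<Omega> \<nu> f v)"
proof -
  let ?e = "\<lambda>x. 1 *\<^sub>R w x + (-1) *\<^sub>R v x" and ?N = "V_dual_norm \<Omega> (residual \<Omega> \<nu> f v)"
  have wV: "w \<in> V_space \<Omega>" using w by (simp add: picard_solution_def)
  have eV: "?e \<in> V_space \<Omega>" by (rule V_space_lincomb[OF wV v])
  note vX = V_space_X[OF v] and wX = V_space_X[OF wV] and eX = V_space_X[OF eV]
  have "V_dual_norm \<Omega> (residual \<Omega> \<nu> f w) \<le> M * grad_norm \<Omega> ?e * grad_norm \<Omega> w"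
    unfolding V_dual_norm_def
  proof (rule dual_norm_le)
    show "0 \<le> M * grad_norm \<Omega> ?e * grad_norm \<Omega> w" using M0 by simp
    fix z assume z: "z \<in> V_space \<Omega>"
    note zX = V_space_X[OF z]
    have "\<nu> * L2_inner \<Omega> (grad \<Omega> w) (grad \<Omega> z) + convection \<Omega> v w z = f z"
      using w z unfolding picard_solution_def by blast
    then have "residual \<Omega> \<nu> f w z = convection \<Omega> ?e w z"
      unfolding residual_def convection_lincomb_1[OF wX wX zX vX] by linarith
    then show "residual \<Omega> \<nu> f w z \<le> M * grad_norm \<Omega> ?e * grad_norm \<Omega> w * grad_norm \<Omega> z"
      using abs_convection_le[OF M eX wX zX] by linarith
  qed
  also have "\<dots> \<le> M * (?N / \<nu>) * (Hm1_norm \<Omega> f / \<nu>)"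
  proof (intro mult_mono mult_left_mono)
    show "grad_norm \<Omega> ?e \<le> ?N / \<nu>"
      using picard_increment_norm_le[OF M f \<nu> v w] \<nu> by (simp add: le_divide_eq mult.commute)
    show "grad_norm \<Omega> w \<le> Hm1_norm \<Omega> f / \<nu>"
      using picard_solution_norm_le[OF M f \<nu> v w] \<nu> by (simp add: le_divide_eq mult.commute)
    show "0 \<le> M * (?N / \<nu>)" using M0 \<nu> residual_norm_nonneg[OF M f v] by simp
  qed (use M0 in simp_all)
  also have "\<dots> = kappa \<Omega> M \<nu> f * ?N"
    using \<nu> by (simp add: kappa_def power_int_minus power2_eq_square field_simps)
  finally show ?thesis .
qed

text \<open>The residual is affine up to its quadratic convective part, and
  \<open>a w \<cdot> \<nabla>w + (1 - a) v \<cdot> \<nabla>v - y \<cdot> \<nabla>y = a (1 - a) e \<cdot> \<nabla>e\<close> for \<open>y = a w + (1 - a) v\<close>, \<open>e = w - v\<close>.\<close>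

lemma residual_of_mixture:
  assumes v: "v \<in> X_space \<Omega>" and w: "w \<in> X_space \<Omega>" and y: "y \<in> X_space \<Omega>" and z: "z \<in> X_space \<Omega>"
    and eq: "AE x in lebesgue_on \<Omega>. y x = a *\<^sub>R w x + (1 - a) *\<^sub>R v x"
  shows "residual \<Omega> \<nu> f y z = a * residual \<Omega> \<nu> f w z + (1 - a) * residual \<Omega> \<nu> f v z
     - a * (1 - a) * convection \<Omega> (\<lambda>x. 1 *\<^sub>R w x + (-1) *\<^sub>R v x) (\<lambda>x. 1 *\<^sub>R w x + (-1) *\<^sub>R v x) z"
proof -
  let ?y = "\<lambda>x. a *\<^sub>R w x + (1 - a) *\<^sub>R v x" and ?e = "\<lambda>x. 1 *\<^sub>R w x + (-1) *\<^sub>R v x"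
  have yX: "?y \<in> X_space \<Omega>" and eX: "?e \<in> X_space \<Omega>" by (intro X_space_lincomb v w)+
  have "residual \<Omega> \<nu> f y z = residual \<Omega> \<nu> f ?y z"
    unfolding residual_def grad_inner_cong[OF y yX z eq] convection_cong_AE[OF y y z yX yX eq eq] ..
  then show ?thesis
    unfolding residual_def grad_inner_lincomb[OF w v z]
      convection_lincomb_1[OF w yX z v] convection_lincomb_2[OF w w z v] convection_lincomb_2[OF v w z v]
      convection_lincomb_1[OF w eX z v]
    by (simp add: algebra_simps)
qed

text \<open>The linear part of the residual contributes \<open>mixed_residual_norm\<close>; the quadratic remainder is bounded
  by the square of the increment, hence by the square of the residual.\<close>

lemma mixture_residual_norm_le:
  assumes M: "convection_bound \<Omega> M" and f: "f \<in> Hm1 \<Omega>" and \<nu>: "\<nu> > 0" and M0: "M \<ge> 0"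
    and v: "v \<in> V_space \<Omega>" and w: "picard_solution \<Omega> \<nu> f v w" and y: "y \<in> V_space \<Omega>"
    and eq: "AE x in lebesgue_on \<Omega>. y x = a *\<^sub>R w x + (1 - a) *\<^sub>R v x"
    and a: "\<bar>a\<bar> \<le> b"
  shows "V_dual_norm \<Omega> (residual \<Omega> \<nu> f y) \<le> mixed_residual_norm \<Omega> \<nu> f w v a
     + M * \<nu> powi (-2) * b * (1 + b) * (V_dual_norm \<Omega> (residual \<Omega> \<nu> f v))\<^sup>2"
proof -
  let ?e = "\<lambda>x. 1 *\<^sub>R w x + (-1) *\<^sub>R v x" and ?N = "V_dual_norm \<Omega> (residual \<Omega> \<nu> f v)"
  let ?m = "mixed_residual_norm \<Omega> \<nu> f w v a"
  have wV: "w \<in> V_space \<Omega>" using w by (simp add: picard_solution_def)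
  have eV: "?e \<in> V_space \<Omega>" by (rule V_space_lincomb[OF wV v])
  note vX = V_space_X[OF v] and wX = V_space_X[OF wV] and eX = V_space_X[OF eV] and yX = V_space_X[OF y]
  have N0: "0 \<le> ?N" by (rule residual_norm_nonneg[OF M f v])
  have m0: "0 \<le> ?m" by (rule mixed_residual_norm_nonneg[OF M f v wV])
  have b: "0 \<le> b" "\<bar>a * (1 - a)\<bar> \<le> b * (1 + b)"
  proof -
    show "0 \<le> b" using a by linarith
    then show "\<bar>a * (1 - a)\<bar> \<le> b * (1 + b)" unfolding abs_mult using a by (intro mult_mono) auto
  qed
  have e: "M * grad_norm \<Omega> ?e * grad_norm \<Omega> ?e \<le> M * \<nu> powi (-2) * ?N\<^sup>2"
  proof -
    have "grad_norm \<Omega> ?e \<le> ?N / \<nu>"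
      using picard_increment_norm_le[OF M f \<nu> v w] \<nu> by (simp add: le_divide_eq mult.commute)
    then have "M * grad_norm \<Omega> ?e * grad_norm \<Omega> ?e \<le> M * (?N / \<nu>) * (?N / \<nu>)"
      using M0 N0 \<nu> by (intro mult_mono mult_left_mono) auto
    also have "\<dots> = M * \<nu> powi (-2) * ?N\<^sup>2"
      using \<nu> by (simp add: power_int_minus power2_eq_square field_simps)
    finally show ?thesis .
  qed
  let ?C = "?m + b * (1 + b) * (M * \<nu> powi (-2) * ?N\<^sup>2)"
  have "V_dual_norm \<Omega> (residual \<Omega> \<nu> f y) \<le> ?C"
  proof (rule dual_norm_le[where W="V_space \<Omega>", folded V_dual_norm_def])
    show "0 \<le> ?C" using m0 b M0 \<nu> by simp
    fix z assume z: "z \<in> V_space \<Omega>"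
    note zX = V_space_X[OF z]
    have "\<bar>a * (1 - a) * convection \<Omega> ?e ?e z\<bar> \<le> b * (1 + b) * (M * grad_norm \<Omega> ?e * grad_norm \<Omega> ?e * grad_norm \<Omega> z)"
      unfolding abs_mult[of "a * (1 - a)"] using b(1) by (intro mult_mono b(2) abs_convection_le[OF M eX eX zX]) auto
    also have "\<dots> \<le> b * (1 + b) * (M * \<nu> powi (-2) * ?N\<^sup>2 * grad_norm \<Omega> z)"
      using b(1) by (intro mult_left_mono mult_right_mono e) auto
    finally have "- (a * (1 - a) * convection \<Omega> ?e ?e z) \<le> b * (1 + b) * (M * \<nu> powi (-2) * ?N\<^sup>2) * grad_norm \<Omega> z"
      unfolding mult.assoc by linarith
    then show "residual \<Omega> \<nu> f y z \<le> ?C * grad_norm \<Omega> z"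
      using residual_of_mixture[OF vX wX yX zX eq, of \<nu> f] mixed_residual_le[OF M f v wV z, of a \<nu>]
      unfolding distrib_right by linarith
  qed
  then show ?thesis by (simp add: mult_ac)
qed

end

theorem theorem3p1:
  fixes \<Omega> :: "(real^'d) set"
    and \<nu> M \<alpha>bar :: real
    and f :: "(real^'d \<Rightarrow> real^'d) \<Rightarrow> real"
    and u ut :: "nat \<Rightarrow> real^'d \<Rightarrow> real^'d"
    and \<alpha> \<theta> \<gamma> :: "nat \<Rightarrow> real"
  assumes "CARD('d) = 2 \<or> CARD('d) = 3"
    and "open \<Omega>" and "bounded \<Omega>" and "connected \<Omega>"
    and "\<nu> > 0"
    and "f \<in> Hm1 \<Omega>"
    and "convection_bound \<Omega> M"
    and "kappa \<Omega> M \<nu> f > 0"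
    and "ngmres0_picard \<Omega> \<nu> f u ut \<alpha>"
    and "\<alpha>bar > 0" and "\<forall>k. \<bar>\<alpha> (Suc k)\<bar> \<le> \<alpha>bar"
    and "\<forall>k. \<theta> (Suc k) = mixed_residual_norm \<Omega> \<nu> f (ut (Suc k)) (u k) (\<alpha> (Suc k))
                         / V_dual_norm \<Omega> (residual \<Omega> \<nu> f (u k))"
    and "\<forall>k. \<gamma> (Suc k) = mixed_residual_norm \<Omega> \<nu> f (ut (Suc k)) (u k) (\<alpha> (Suc k))
                         / V_dual_norm \<Omega> (residual \<Omega> \<nu> f (ut (Suc k)))"
  shows "\<forall>k.
     (V_dual_norm \<Omega> (residual \<Omega> \<nu> f (u k)) \<noteq> 0 \<longrightarrow>
        V_dual_norm \<Omega> (residual \<Omega> \<nu> f (u (Suc k)))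
        \<le> \<theta> (Suc k) * V_dual_norm \<Omega> (residual \<Omega> \<nu> f (u k))
          + M * \<nu> powi (-2) * \<alpha>bar * (1 + \<alpha>bar) * (V_dual_norm \<Omega> (residual \<Omega> \<nu> f (u k)))\<^sup>2) \<and>
     (V_dual_norm \<Omega> (residual \<Omega> \<nu> f (ut (Suc k))) \<noteq> 0 \<longrightarrow>
        V_dual_norm \<Omega> (residual \<Omega> \<nu> f (u (Suc k)))
        \<le> \<gamma> (Suc k) * kappa \<Omega> M \<nu> f * V_dual_norm \<Omega> (residual \<Omega> \<nu> f (u k))
          + M * \<nu> powi (-2) * \<alpha>bar * (1 + \<alpha>bar) * (V_dual_norm \<Omega> (residual \<Omega> \<nu> f (u k)))\<^sup>2)"
proof
  fix k
  interpret flow_domain \<Omega>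
    using assms(1-3) by unfold_locales
  let ?N = "V_dual_norm \<Omega> (residual \<Omega> \<nu> f (u k))"
  let ?Nt = "V_dual_norm \<Omega> (residual \<Omega> \<nu> f (ut (Suc k)))"
  let ?N' = "V_dual_norm \<Omega> (residual \<Omega> \<nu> f (u (Suc k)))"
  let ?m = "mixed_residual_norm \<Omega> \<nu> f (ut (Suc k)) (u k) (\<alpha> (Suc k))"
  let ?r = "M * \<nu> powi (-2) * \<alpha>bar * (1 + \<alpha>bar) * ?N\<^sup>2"
  note \<nu> = assms(5) and f = assms(6) and M = assms(7)
  have v: "u k \<in> V_space \<Omega>" and y: "u (Suc k) \<in> V_space \<Omega>" and w: "picard_solution \<Omega> \<nu> f (u k) (ut (Suc k))"
    and eq: "AE x in lebesgue_on \<Omega>. u (Suc k) x = \<alpha> (Suc k) *\<^sub>R ut (Suc k) x + (1 - \<alpha> (Suc k)) *\<^sub>R u k x"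
    using assms(9) unfolding ngmres0_picard_def by blast+
  have wV: "ut (Suc k) \<in> V_space \<Omega>" using w by (simp add: picard_solution_def)
  \<comment> \<open>The sign of \<open>M\<close> comes from \<open>\<kappa> > 0\<close>, because \<open>\<parallel>f\<parallel>\<close> is nonnegative.\<close>
  have "0 < M * \<nu> powi (-2)"
    using assms(8) Hm1_norm_nonneg[OF f] unfolding kappa_def zero_less_mult_iff by linarith
  moreover have "0 < \<nu> powi (-2)" using \<nu> by simp
  ultimately have M0: "0 \<le> M" using zero_less_mult_pos2 less_imp_le by blast
  have main: "?N' \<le> ?m + ?r"
    using assms(11) by (intro mixture_residual_norm_le[OF M f \<nu> M0 v w y eq]) blast
  show "(?N \<noteq> 0 \<longrightarrow> ?N' \<le> \<theta> (Suc k) * ?N + ?r) \<and> (?Nt \<noteq> 0 \<longrightarrow> ?N' \<le> \<gamma> (Suc k) * kappa \<Omega> M \<nu> f * ?N + ?r)"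
  proof (intro conjI impI)
    assume "?N \<noteq> 0"
    then have "?m = \<theta> (Suc k) * ?N" using assms(12) by simp
    then show "?N' \<le> \<theta> (Suc k) * ?N + ?r" using main by simp
  next
    assume Nt: "?Nt \<noteq> 0"
    have "0 \<le> \<gamma> (Suc k)"
      using assms(13) mixed_residual_norm_nonneg[OF M f v wV] residual_norm_nonneg[OF M f wV] by simp
    moreover have "?Nt \<le> kappa \<Omega> M \<nu> f * ?N" by (rule picard_residual_le[OF M f \<nu> M0 v w])
    ultimately have "\<gamma> (Suc k) * ?Nt \<le> \<gamma> (Suc k) * (kappa \<Omega> M \<nu> f * ?N)" by (intro mult_left_mono)
    moreover have "?m = \<gamma> (Suc k) * ?Nt" using assms(13) Nt by simp
    ultimately show "?N' \<le> \<gamma> (Suc k) * kappa \<Omega> M \<nu> f * ?N + ?r" using main by (simp add: mult.assoc)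
  qed
qed

end
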